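(* Let $w=(w_k)_{k\ge0}$ be a weight sequence with $w_0>0$ and $w_k>0$ for some $k\ge1$. Suppose that $n\to\infty$ and $m=m(n)$ with $m/n\to\lambda$, where $0<\lambda<\omega$, and let $\tau$ be the unique number in $[0,\rho]$ with $\Psi(\tau)=\lambda$ if $\lambda\le\nu$, and $\tau=\rho$ if $\lambda>\nu$. If $\rho>0$, then for every fixed $k\in\mathbb Z$ with $\mathrm{span}(w)\mid k$, $$\frac{Z(m+k,n)}{Z(m,n)}\to\tau^{-k}.$$
   Context: A weight sequence is a sequence $w=(w_k)_{k\ge0}$ of nonnegative reals; $\omega=\sup\{k:w_k>0\}$; $\mathrm{span}(w)$ is the largest $d\ge1$ dividing every $k$ with $w_k>0$. $\Phi(t)=\sum_kw_kt^k$, $\rho$ its radius of convergence; $\Psi(t)=t\Phi'(t)/\Phi(t)$ for $\Phi(t)<\infty$, $\Psi(\rho)=\lim_{t\uparrow\rho}\Psi(t)$ if $\Phi(\rho)=\infty$; $\nu=\Psi(\rho)$. $Z(m,n)=\sum\prod_{i=1}^nw_{y_i}$ over all $(y_1,\dots,y_n)\in\{0,1,\dots\}^n$ with $\sum y_i=m$ (and $Z(m,n)=0$ if $m<0$); the limit is along $n$ with $Z(m,n)>0$. *)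

theory Defs
  imports "HOL-Analysis.Analysis"
begin

definition weight_seq :: "(nat \<Rightarrow> real) \<Rightarrow> bool" where
  "weight_seq w \<longleftrightarrow> (\<forall>k. w k \<ge> 0)"

definition omega :: "(nat \<Rightarrow> real) \<Rightarrow> ereal" where
  "omega w = Sup {ereal (real k) | k. w k > 0}"

definition span :: "(nat \<Rightarrow> real) \<Rightarrow> nat" where
  "span w = (GREATEST d. d \<ge> 1 \<and> (\<forall>k. w k > 0 \<longrightarrow> d dvd k))"

definition Phi :: "(nat \<Rightarrow> real) \<Rightarrow> real \<Rightarrow> ennreal" where
  "Phi w t = (\<Sum>k. ennreal (w k * t ^ k))"

definition PhiD :: "(nat \<Rightarrow> real) \<Rightarrow> real \<Rightarrow> ennreal" where
  "PhiD w t = (\<Sum>k. ennreal (real k * w k * t ^ (k - 1)))"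

definition Psi0 :: "(nat \<Rightarrow> real) \<Rightarrow> real \<Rightarrow> ennreal" where
  "Psi0 w t = ennreal t * PhiD w t / Phi w t"

definition Psi :: "(nat \<Rightarrow> real) \<Rightarrow> real \<Rightarrow> ennreal" where
  "Psi w t = (if Phi w t < \<infinity> then Psi0 w t else Lim (at_left t) (Psi0 w))"

definition nu :: "(nat \<Rightarrow> real) \<Rightarrow> ennreal" where
  "nu w = (if conv_radius w = \<infinity> then Lim at_top (Psi0 w)
           else Psi w (real_of_ereal (conv_radius w)))"

definition Z :: "(nat \<Rightarrow> real) \<Rightarrow> int \<Rightarrow> nat \<Rightarrow> real" where
  "Z w m n = (if m < 0 then 0 else
     (\<Sum>y \<in> {y :: nat \<Rightarrow> nat. (\<forall>i\<ge>n. y i = 0) \<and> int (\<Sum>i<n. y i) = m}.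
        \<Prod>i<n. w (y i)))"

end

theory Submission
  imports Defs "HOL-Computational_Algebra.Group_Closure"
begin

text \<open>
  Write \<open>p j = w j * tau ^ j / Phi w tau\<close>. In the conditioned allocation of \<open>m\<close> balls to \<open>n\<close>
  boxes, the mean proportion of boxes with \<open>j\<close> balls is \<open>w j * Z w (m - j) (n - 1) / Z w m n\<close>.
  Multiplying \<open>w j\<close> by \<open>exp s\<close> and applying Jensen's inequality and the bound
  \<open>Z w m n * tau ^ m \<le> Phi w tau ^ n\<close> to the new weights controls this proportion
  from above (\<open>s > 0\<close>) and below (\<open>s < 0\<close>), provided that \<open>Z w m n\<close> itself is not exponentially
  smaller than \<open>Phi w tau ^ n / tau ^ m\<close>. The latter holds because \<open>tau\<close> minimizes
  \<open>Phi w t * t powr (- lam)\<close>: truncate the weights, tilt them to mean \<open>lam\<close>, and use a Chernoff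
  bound. So the proportion tends to \<open>p j\<close>, and the quotient of the limits for \<open>j\<close> and for \<open>0\<close> is the
  claim for \<open>k = - j\<close> with \<open>w j > 0\<close>. The admissible \<open>k\<close> form a group, hence all multiples of the
  span are reached.
\<close>

section \<open>Elementary properties of the partition function\<close>

lemma finite_allocations:
  "finite {y :: nat \<Rightarrow> nat. (\<forall>i\<ge>n. y i = 0) \<and> int (\<Sum>i<n. y i) = m}"
proof (rule finite_subset)
  show "finite {y. \<forall>i. (i \<in> {..<n} \<longrightarrow> y i \<in> {..nat m}) \<and> (i \<notin> {..<n} \<longrightarrow> y i = (0::nat))}"
    by (rule finite_set_of_finite_funs) auto
  have "y i \<le> nat m" if "int (\<Sum>i<n. y i) = m" "i < n" for y i
  proof -
    have "y i \<le> (\<Sum>i<n. y i)"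
      using that by (intro member_le_sum) auto
    then show ?thesis
      using that(1) by linarith
  qed
  then show "{y :: nat \<Rightarrow> nat. (\<forall>i\<ge>n. y i = 0) \<and> int (\<Sum>i<n. y i) = m}
    \<subseteq> {y. \<forall>i. (i \<in> {..<n} \<longrightarrow> y i \<in> {..nat m}) \<and> (i \<notin> {..<n} \<longrightarrow> y i = (0::nat))}"
    by auto
qed

lemma Z_neg: "m < 0 \<Longrightarrow> Z w m n = 0"
  by (simp add: Z_def)

lemma Z_0: "Z w m 0 = (if m = 0 then 1 else 0)"
proof -
  have "{y :: nat \<Rightarrow> nat. (\<forall>i. y i = 0) \<and> m = 0} = (if m = 0 then {\<lambda>_. 0} else {})"
    by auto
  then show ?thesis
    by (auto simp: Z_def)
qed

text \<open>Conditioning on the content \<open>i\<close> of the last box. Terms with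
  \<open>i > m\<close> vanish by the convention for negative arguments, so every \<open>K\<close>
  that is at least \<open>nat m\<close> gives the same sum; this freedom lets recursions for
  different totals share one index range.\<close>

lemma Z_Suc:
  assumes "nat m \<le> K"
  shows "Z w m (Suc n) = (\<Sum>i\<le>K. w i * Z w (m - int i) n)"
proof (cases "m < 0")
  case True
  then show ?thesis by (simp add: Z_neg)
next
  case False
  define S where "S = (\<lambda>n (m::int). {y :: nat \<Rightarrow> nat. (\<forall>i\<ge>n. y i = 0) \<and> int (\<Sum>i<n. y i) = m})"
  have fin: "finite (S n m)" for n m
    unfolding S_def by (rule finite_allocations)
  have Z_S: "Z w m n = (\<Sum>y\<in>S n m. \<Prod>i<n. w (y i))" for m n
  proof (cases "m < 0")
    case True
    then have "S n m = {}"
      unfolding S_def by (auto simp del: of_nat_sum)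
    with True show ?thesis by (simp add: Z_neg)
  qed (simp add: Z_def S_def)
  have "(\<Sum>i\<le>K. w i * Z w (m - int i) n)
      = (\<Sum>i\<le>K. \<Sum>y\<in>S n (m - int i). w i * (\<Prod>j<n. w (y j)))"
    by (simp add: Z_S sum_distrib_left)
  also have "\<dots> = (\<Sum>(i, y)\<in>(SIGMA i:{..K}. S n (m - int i)). w i * (\<Prod>j<n. w (y j)))"
    by (rule sum.Sigma) (auto simp: fin)
  also have "\<dots> = (\<Sum>y\<in>S (Suc n) m. \<Prod>j<Suc n. w (y j))"
  \<comment> \<open>The last coordinate \<open>y n\<close> is split off. It is reset to
    \<open>0\<close> because members of \<open>S n\<close> vanish from \<open>n\<close> on.\<close>
  proof (rule sum.reindex_bij_witness[where i = "\<lambda>y. (y n, y(n := 0))" and j = "\<lambda>(i, y). y(n := i)"],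
      goal_cases)
    case (1 a)
    then show ?case by (auto simp: S_def)
  next
    case (2 a)
    have "(\<Sum>j<n. ((snd a)(n := fst a)) j) = (\<Sum>j<n. snd a j)"
      by (rule sum.cong) auto
    with 2 show ?case by (auto simp: S_def)
  next
    case (3 b)
    then show ?case by auto
  next
    case (4 b)
    have "(\<Sum>j<n. (b(n := 0)) j) = (\<Sum>j<n. b j)"
      by (rule sum.cong) auto
    moreover have "int (\<Sum>j<Suc n. b j) = m"
      using 4 by (simp only: S_def mem_Collect_eq)
    then have "b n \<le> K"
      using assms unfolding sum.lessThan_Suc by linarith
    ultimately show ?case
      using 4 by (auto simp: S_def dest: le_neq_implies_less)
  next
    case (5 a)
    have "(\<Prod>j<n. w (((snd a)(n := fst a)) j)) = (\<Prod>j<n. w (snd a j))"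
      by (rule prod.cong) auto
    then show ?case by (auto simp: mult.commute split: prod.splits)
  qed
  finally show ?thesis
    by (simp add: Z_S)
qed

lemma Z_1: "Z w (int j) 1 = w j"
proof -
  have "Z w (int j) (Suc 0) = (\<Sum>i\<le>j. if i = j then w j else 0)"
    unfolding Z_Suc[of "int j" j, simplified] by (rule sum.cong) (auto simp: Z_0)
  then show ?thesis by simp
qed

lemma Z_nonneg:
  assumes "\<And>i. w i \<ge> 0"
  shows "Z w m n \<ge> 0"
  by (auto simp: Z_def intro!: sum_nonneg prod_nonneg assms)

lemma Z_mono:
  assumes "\<And>i. 0 \<le> v i" "\<And>i. v i \<le> w i"
  shows "Z v m n \<le> Z w m n"
  by (auto simp: Z_def intro!: sum_mono prod_mono assms)

text \<open>Concatenating an allocation of \<open>m1\<close> balls to \<open>n1\<close> boxes with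
  one of \<open>m2\<close> balls to \<open>n2\<close> boxes is injective, so the product is part of
  the larger sum. The induction removes the boxes of the first block one by one.\<close>

lemma Z_mult_le:
  assumes w: "\<And>i. w i \<ge> 0"
  shows "Z w m1 n1 * Z w m2 n2 \<le> Z w (m1 + m2) (n1 + n2)"
proof (cases "m1 < 0 \<or> m2 < 0")
  case True
  then show ?thesis using Z_nonneg[OF w] by (auto simp: Z_neg)
next
  case False
  then have "m2 \<ge> 0" by auto
  then show ?thesis
  proof (induction n1 arbitrary: m1)
    case 0
    then show ?case using Z_nonneg[OF w] by (auto simp: Z_0)
  next
    case (Suc n1)
    have "Z w m1 (Suc n1) * Z w m2 n2 = (\<Sum>i\<le>nat (m1 + m2). w i * (Z w (m1 - int i) n1 * Z w m2 n2))"
      using Suc.prems by (subst Z_Suc[of _ "nat (m1 + m2)"]) (auto simp: sum_distrib_right mult.assoc)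
    also have "\<dots> \<le> (\<Sum>i\<le>nat (m1 + m2). w i * Z w (m1 + m2 - int i) (n1 + n2))"
    proof (rule sum_mono, rule mult_left_mono[OF _ w])
      fix i
      show "Z w (m1 - int i) n1 * Z w m2 n2 \<le> Z w (m1 + m2 - int i) (n1 + n2)"
        using Suc.IH[OF Suc.prems, of "m1 - int i"] by (simp add: algebra_simps)
    qed
    also have "\<dots> = Z w (m1 + m2) (Suc n1 + n2)"
      by (simp add: Z_Suc[of _ "nat (m1 + m2)"])
    finally show ?case .
  qed
qed

lemma Z_power_le:
  assumes w: "\<And>i. w i \<ge> 0"
  shows "Z w m n ^ q \<le> Z w (int q * m) (q * n)"
proof (induction q)
  case 0
  then show ?case by (simp add: Z_0)
next
  case (Suc q)
  have "Z w m n ^ Suc q \<le> Z w m n * Z w (int q * m) (q * n)"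
    using Suc Z_nonneg[OF w] by (simp add: mult_left_mono)
  also have "\<dots> \<le> Z w (int (Suc q) * m) (Suc q * n)"
    using Z_mult_le[of w m n "int q * m" "q * n", OF w] by (simp add: algebra_simps)
  finally show ?case .
qed

text \<open>\<open>Z w m n\<close> is the coefficient of \<open>t ^ m\<close> in the
  \<open>n\<close>-th power of the generating function, whose terms are all nonnegative. Since
  \<open>S\<close> only bounds partial sums, truncated and infinite series are treated
  alike.\<close>

lemma Z_chernoff:
  assumes w: "\<And>i. w i \<ge> 0" and t: "t > 0" and S: "\<And>K. (\<Sum>i\<le>K. w i * t ^ i) \<le> S"
  shows "Z w m n * t powi m \<le> S ^ n"
proof (induction n arbitrary: m)
  case 0
  then show ?case by (simp add: Z_0)
next
  case (Suc n)
  have S0: "S \<ge> 0"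
    using S[of 0] w[of 0] by simp
  have "Z w m (Suc n) * t powi m = (\<Sum>i\<le>nat m. (w i * t ^ i) * (Z w (m - int i) n * t powi (m - int i)))"
    using t by (subst Z_Suc[OF order_refl])
      (auto simp: sum_distrib_right power_int_diff intro!: sum.cong)
  also have "\<dots> \<le> (\<Sum>i\<le>nat m. (w i * t ^ i) * S ^ n)"
    using t w by (intro sum_mono mult_left_mono Suc) auto
  also have "\<dots> \<le> S ^ Suc n"
    using S[of "nat m"] S0 by (simp add: sum_distrib_right[symmetric] mult_right_mono)
  finally show ?case .
qed

text \<open>Jensen's inequality for the number of boxes that contain \<open>j\<close> balls: with \<open>a\<close> equal to
  \<open>s\<close> times its mean under the conditioned allocation, the bracket is just \<open>Z w m n\<close>.
  Leaving \<open>a\<close> free makes the induction over \<open>n\<close> work, since it can absorb the factor \<open>exp s\<close>.\<close>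

lemma Z_tilt_ge:
  fixes s :: real
  assumes w: "\<And>i. w i \<ge> 0"
  shows "exp a * ((1 - a) * Z w m n + s * real n * w j * Z w (m - int j) (n - 1))
    \<le> Z (w(j := exp s * w j)) m n"
proof (induction n arbitrary: m a)
  case 0
  have "exp a * (1 - a) \<le> exp a * exp (- a)"
    using exp_ge_add_one_self[of "- a"] by (intro mult_left_mono) auto
  then show ?case
    by (simp add: Z_0 exp_minus)
next
  case (Suc n)
  let ?v = "w(j := exp s * w j)"
  \<comment> \<open>One range for the recursions at \<open>m\<close> and at
    \<open>m - int j\<close>. Adding \<open>j\<close> ensures that the index \<open>j\<close>, which
    carries the factor \<open>exp s\<close>, occurs in it.\<close>
  define K where "K = nat m + j"
  have le: "w i * exp a * ((1 - a + (if i = j then s else 0)) * Z w (m - int i) n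
      + s * real n * w j * Z w (m - int i - int j) (n - 1)) \<le> ?v i * Z ?v (m - int i) n" (is "?l i \<le> _") for i
  proof (cases "i = j")
    case True
    have "?l i = ?v i * (exp (a - s) * ((1 - (a - s)) * Z w (m - int i) n
      + s * real n * w j * Z w (m - int i - int j) (n - 1)))"
      using True by (simp add: exp_diff)
    also have "\<dots> \<le> ?v i * Z ?v (m - int i) n"
      using w by (intro mult_left_mono Suc) auto
    finally show ?thesis .
  next
    case False
    have "?l i = ?v i * (exp a * ((1 - a) * Z w (m - int i) n
      + s * real n * w j * Z w (m - int i - int j) (n - 1)))"
      using False by simp
    also have "\<dots> \<le> ?v i * Z ?v (m - int i) n"
      using w by (intro mult_left_mono Suc) auto
    finally show ?thesis .
  qed
  have "Z w (m - int j) n * real n = real n * (\<Sum>i\<le>K. w i * Z w (m - int i - int j) (n - 1))"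
  proof (cases n)
    case (Suc n')
    then show ?thesis
      by (auto simp: Z_Suc[of _ K] K_def algebra_simps)
  qed simp
  then have *: "s * real n * w j * Z w (m - int j) n
      = s * w j * (real n * (\<Sum>i\<le>K. w i * Z w (m - int i - int j) (n - 1)))"
    by (metis (no_types, lifting) mult.assoc mult.commute)
  have "exp a * ((1 - a) * Z w m (Suc n) + s * real (Suc n) * w j * Z w (m - int j) (Suc n - 1))
    = exp a * ((1 - a) * (\<Sum>i\<le>K. w i * Z w (m - int i) n) + s * w j * Z w (m - int j) n
      + s * w j * (real n * (\<Sum>i\<le>K. w i * Z w (m - int i - int j) (n - 1))))"
    unfolding *[symmetric] Z_Suc[of m K, unfolded K_def, simplified, folded K_def]
    by (simp add: algebra_simps)
  also have "s * w j * Z w (m - int j) n = (\<Sum>i\<le>K. if i = j then s * w j * Z w (m - int j) n else 0)"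
    by (simp add: K_def)
  also have "exp a * ((1 - a) * (\<Sum>i\<le>K. w i * Z w (m - int i) n)
      + (\<Sum>i\<le>K. if i = j then s * w j * Z w (m - int j) n else 0)
      + s * w j * (real n * (\<Sum>i\<le>K. w i * Z w (m - int i - int j) (n - 1)))) = (\<Sum>i\<le>K. ?l i)"
    unfolding sum_distrib_left sum.distrib[symmetric]
    by (rule sum.cong) (auto simp: algebra_simps)
  also have "\<dots> \<le> (\<Sum>i\<le>K. ?v i * Z ?v (m - int i) n)"
    by (rule sum_mono) (rule le)
  also have "\<dots> = Z ?v m (Suc n)"
    by (rule Z_Suc[symmetric]) (simp add: K_def)
  finally show ?case .
qed

section \<open>The span and crude lower bounds\<close>

text \<open>A positive index in the support makes the gcd nonzero; otherwise every \<open>d\<close>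
  would qualify and \<open>GREATEST\<close> would have no maximum to pick.\<close>

lemma span_eq_Gcd:
  assumes "\<exists>j\<ge>1. w j > 0"
  shows "span w = Gcd {k. w k > 0}"
  unfolding span_def
proof (rule Greatest_equality)
  obtain j where j: "j \<ge> 1" "w j > 0" using assms by blast
  then have "Gcd {k. w k > 0} \<noteq> 0"
    by (auto simp: Gcd_0_iff)
  then show "1 \<le> Gcd {k. w k > 0} \<and> (\<forall>k. w k > 0 \<longrightarrow> Gcd {k. w k > 0} dvd k)"
    by (metis (no_types, lifting) Gcd_dvd One_nat_def Suc_leI bot_nat_0.not_eq_extremum mem_Collect_eq)
  fix d assume "1 \<le> d \<and> (\<forall>k. w k > 0 \<longrightarrow> d dvd k)"
  then have "d dvd Gcd {k. w k > 0}"
    by (auto intro: Gcd_greatest)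
  with \<open>Gcd {k. w k > 0} \<noteq> 0\<close> show "d \<le> Gcd {k. w k > 0}"
    by (intro dvd_imp_le) blast+
qed

lemma span_dvd:
  assumes "\<exists>j\<ge>1. w j > 0" "w k > 0"
  shows "span w dvd k"
  using assms(2) by (auto simp: span_eq_Gcd[OF assms(1)] intro: Gcd_dvd)

text \<open>Bezout's principle in closure form. It serves twice: for differences of attainable
  totals, and for the shifts \<open>k\<close> at which the ratio limit holds.\<close>

lemma multiple_of_span_in_subgroup:
  fixes H :: "int set"
  assumes ex: "\<exists>j\<ge>1. w j > 0"
    and S: "\<And>k. w k > 0 \<Longrightarrow> int k \<in> H" and zero: "0 \<in> H"
    and diff: "\<And>a b. a \<in> H \<Longrightarrow> b \<in> H \<Longrightarrow> a - b \<in> H"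
    and k: "int (span w) dvd k"
  shows "k \<in> H"
proof -
  have "k \<in> group_closure (int ` {k. w k > 0})"
    using k by (auto simp: group_closure_eq span_eq_Gcd[OF ex])
  then show ?thesis
    by induction (auto intro: S zero diff)
qed

section \<open>Attainable totals and a lower bound of the form \<open>c ^ n\<close>\<close>

lemma span_dvd_if_Z_nonzero:
  assumes w: "\<And>i. w i \<ge> 0" and ex: "\<exists>j\<ge>1. w j > 0" and nz: "Z w m n \<noteq> 0"
  shows "int (span w) dvd m"
  using nz
proof (induction n arbitrary: m)
  case 0
  then show ?case by (simp add: Z_0 split: if_splits)
next
  case (Suc n)
  then have "(\<Sum>i\<le>nat m. w i * Z w (m - int i) n) \<noteq> 0"
    using Z_Suc[of m "nat m" w n] by simp
  then obtain i where "w i * Z w (m - int i) n \<noteq> 0"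
    by (meson sum.neutral)
  then have "int (span w) dvd m - int i" "w i > 0"
    using Suc.IH w[of i] by auto
  then have "int (span w) dvd (m - int i) + int i"
    using span_dvd[OF ex, of i] by (intro dvd_add) auto
  then show ?case by simp
qed

text \<open>The attainable totals form a numerical semigroup with gcd \<open>span w\<close>, and
  such a semigroup contains all sufficiently large multiples of its gcd.\<close>

lemma Z_pos_of_large_multiple:
  assumes w: "\<And>i. w i \<ge> 0" and ex: "\<exists>j\<ge>1. w j > 0"
  obtains X where "X \<ge> 0" "\<And>y. y \<ge> X \<Longrightarrow> int (span w) dvd y \<Longrightarrow> \<exists>L. Z w y L > 0"
proof -
  define d where "d = int (span w)"
  define T where "T = {y. \<exists>L. Z w y L > 0}"
  have T_add: "a + b \<in> T" if T: "a \<in> T" "b \<in> T" for a b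
  proof -
    obtain L1 L2 where "Z w a L1 > 0" "Z w b L2 > 0"
      using T unfolding T_def by blast
    then have "Z w (a + b) (L1 + L2) > 0"
      using Z_mult_le[of w a L1 b L2, OF w] mult_pos_pos[of "Z w a L1" "Z w b L2"] by linarith
    then show ?thesis by (auto simp: T_def)
  qed
  have T0: "0 \<in> T"
    by (auto simp: T_def intro!: exI[of _ 0] simp: Z_0)
  have T_supp: "int k \<in> T" if "w k > 0" for k
    using that Z_1[of w k] unfolding T_def by (metis mem_Collect_eq)
  have T_nonneg: "a \<ge> 0" if "a \<in> T" for a
    using that Z_neg[of a w] unfolding T_def by (cases "a < 0") auto
  have T_nat: "int q * a \<in> T" if "a \<in> T" for q a
    by (induction q) (use T_add[OF that] T0 in \<open>auto simp: distrib_right\<close>)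
  have T_mult: "q * a \<in> T" if "a \<in> T" "q \<ge> 0" for q a
    using T_nat[OF that(1), of "nat q"] that by simp
  \<comment> \<open>The differences of attainable totals form a group containing the support, hence
    the span itself.\<close>
  have "d \<in> {a - b | a b. a \<in> T \<and> b \<in> T}"
  proof (rule multiple_of_span_in_subgroup[OF ex])
    fix x y assume "x \<in> {a - b | a b. a \<in> T \<and> b \<in> T}" "y \<in> {a - b | a b. a \<in> T \<and> b \<in> T}"
    then obtain a b a' b' where "x = a - b" "y = a' - b'" "a \<in> T" "b \<in> T" "a' \<in> T" "b' \<in> T"
      by blast
    then have "x - y = (a + b') - (a' + b)" "a + b' \<in> T" "a' + b \<in> T"
      by (auto intro: T_add)
    then show "x - y \<in> {a - b | a b. a \<in> T \<and> b \<in> T}" by blast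
  next
    fix k assume "w k > 0"
    then show "int k \<in> {a - b | a b. a \<in> T \<and> b \<in> T}"
      using T_supp T0 by (metis (mono_tags, lifting) diff_zero mem_Collect_eq)
  next
    show "0 \<in> {a - b | a b. a \<in> T \<and> b \<in> T}"
      using T0 by force
  qed (simp add: d_def)
  then obtain a0 b0 where ab0: "a0 \<in> T" "b0 \<in> T" "d = a0 - b0" by blast
  obtain j where j: "j \<ge> 1" "w j > 0" using ex by blast
  \<comment> \<open>Adding \<open>int j\<close> to both keeps the difference \<open>d\<close> and
    makes \<open>b\<close> positive.\<close>
  define a b where "a = a0 + int j" and "b = b0 + int j"
  have ab: "a \<in> T" "b \<in> T" "a = b + d"
    using ab0 T_supp[OF j(2)] by (auto simp: a_def b_def intro: T_add)
  have "b > 0" using T_nonneg[OF ab0(2)] j by (simp add: b_def)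
  have "d dvd b"
    using ab(2) span_dvd_if_Z_nonzero[OF w ex, of b] by (fastforce simp: T_def d_def)
  then obtain b' where b': "b = d * b'" ..
  have "d \<ge> 0" by (simp add: d_def)
  then have "d > 0" "b' > 0" using \<open>b > 0\<close> b' zero_less_mult_iff[of d b'] by auto
  show ?thesis
  proof (rule that[of "b * b'"])
    show "b * b' \<ge> 0" using \<open>b > 0\<close> \<open>b' > 0\<close> by simp
    fix y assume y: "y \<ge> b * b'" "int (span w) dvd y"
    then obtain y' where y': "y = d * y'" by (auto simp: d_def)
    have "b' * b' \<le> y'"
      using y(1) \<open>d > 0\<close> by (simp add: b' y' mult.assoc)
    \<comment> \<open>Division with remainder gives \<open>y = (q - r) * b + r * a\<close>. The
      coefficient \<open>q - r\<close> is nonnegative because \<open>r < b'\<close> and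
      \<open>b' <= q\<close>, which is where the bound \<open>b * b'\<close> comes from.\<close>
    define q r where "q = y' div b'" and "r = y' mod b'"
    have r: "0 \<le> r" "r < b'" using \<open>b' > 0\<close> by (auto simp: r_def)
    have "b' \<le> q"
      using \<open>b' * b' \<le> y'\<close> \<open>b' > 0\<close> unfolding q_def
      by (metis less_irrefl nonzero_mult_div_cancel_right zdiv_mono1)
    have "y' = b' * q + r" by (simp add: q_def r_def)
    then have "y = (q - r) * b + r * a"
      by (simp add: y' b' ab(3) algebra_simps)
    moreover have "(q - r) * b + r * a \<in> T"
      using r \<open>b' \<le> q\<close> by (intro T_add T_mult ab) auto
    ultimately show "\<exists>L. Z w y L > 0" by (simp add: T_def)
  qed
qed

text \<open>A single kind of allocation suffices: \<open>q\<close> boxes with \<open>J\<close> balls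
  each, one block for the remainder \<open>s\<close>, and empty boxes elsewhere. Only finitely many
  remainders occur, so their weights have a common positive lower bound.\<close>

lemma Z_ge_power:
  assumes w: "\<And>i. w i \<ge> 0" and w0: "w 0 > 0" and ex: "\<exists>j\<ge>1. w j > 0"
    and B: "0 < B" "ereal B < omega w"
  obtains c X n0 where "c > 0" "X \<ge> 0"
    "\<forall>m n. X \<le> m \<longrightarrow> real_of_int m \<le> B * real n \<longrightarrow> n \<ge> n0 \<longrightarrow> int (span w) dvd m \<longrightarrow> Z w m n \<ge> c ^ n"
proof -
  obtain J where J: "w J > 0" "B < real J"
    using B(2) by (auto simp: omega_def less_Sup_iff)
  obtain X where X: "X \<ge> 0" "\<And>y. y \<ge> X \<Longrightarrow> int (span w) dvd y \<Longrightarrow> \<exists>L. Z w y L > 0"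
    using Z_pos_of_large_multiple[of w, OF w ex] by blast
  define R where "R = {s \<in> {X..<X + int J}. int (span w) dvd s}"
  have "finite R"
    unfolding R_def by (rule finite_subset[of _ "{X..<X + int J}"]) auto
  have "\<forall>s\<in>R. \<exists>L. Z w s L > 0"
    using X(2) by (auto simp: R_def)
  then obtain L where L: "\<And>s. s \<in> R \<Longrightarrow> Z w s (L s) > 0"
    by metis
  \<comment> \<open>A common length for all remainder blocks; shorter ones are padded with empty
    boxes.\<close>
  define L0 where "L0 = (\<Sum>s\<in>R. L s)"
  have Z0: "w 0 ^ q \<le> Z w 0 q" for q
    using Z_power_le[of w 0 1 q, OF w] Z_1[of w 0] by simp
  have ZJ: "w J ^ q \<le> Z w (int q * int J) q" for q
    using Z_power_le[of w "int J" 1 q, OF w] Z_1[of w J] by simp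
  have pos: "Z w s L0 > 0" if "s \<in> R" for s
  proof -
    have "L s \<le> L0" unfolding L0_def using that \<open>finite R\<close> by (intro member_le_sum) auto
    have "0 < Z w s (L s) * w 0 ^ (L0 - L s)"
      using L[OF that] w0 by simp
    also have "\<dots> \<le> Z w s (L s) * Z w 0 (L0 - L s)"
      using L[OF that] by (intro mult_left_mono Z0) auto
    also have "\<dots> \<le> Z w s L0"
      using Z_mult_le[of w s "L s" 0 "L0 - L s", OF w] \<open>L s \<le> L0\<close> by simp
    finally show ?thesis .
  qed
  \<comment> \<open>Inserting \<open>1\<close> covers an empty \<open>R\<close> and gives
    \<open>mu <= 1\<close>, so that \<open>mu ^ n <= mu\<close> for \<open>n >= 1\<close>.\<close>
  define mu where "mu = Min (insert 1 ((\<lambda>s. Z w s L0) ` R))"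
  have mu: "mu > 0" "mu \<le> 1" "\<And>s. s \<in> R \<Longrightarrow> mu \<le> Z w s L0"
    using \<open>finite R\<close> pos by (auto simp: mu_def)
  define c where "c = min 1 (min (w J) (w 0))"
  have c: "0 < c" "c \<le> 1" "c \<le> w J" "c \<le> w 0"
    using J w0 by (auto simp: c_def)
  \<comment> \<open>The full boxes take at most the proportion \<open>B / real J\<close>; from
    \<open>n0\<close> on, the remaining proportion has room for \<open>L0\<close> boxes.\<close>
  define n0 where "n0 = Suc (nat \<lceil>real L0 / (1 - B / real J)\<rceil>)"
  show ?thesis
  proof (rule that[of "mu * c" X n0])
    show "mu * c > 0" "X \<ge> 0" using mu c X by auto
    show "\<forall>m n. X \<le> m \<longrightarrow> real_of_int m \<le> B * real n \<longrightarrow> n \<ge> n0 \<longrightarrow> int (span w) dvd m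
      \<longrightarrow> Z w m n \<ge> (mu * c) ^ n"
    proof (intro allI impI)
      fix m :: int and n :: nat
      assume m: "X \<le> m" "real_of_int m \<le> B * real n" "n \<ge> n0" "int (span w) dvd m"
      have J0: "int J > 0" using J B by linarith
      define q where "q = nat ((m - X) div int J)"
      define s where "s = X + (m - X) mod int J"
      have q: "int q = (m - X) div int J"
        using m(1) J0 by (simp add: q_def pos_imp_zdiv_nonneg_iff)
      have ms: "m = s + int q * int J"
        using q by (simp add: s_def)
      have "s \<in> R"
      proof -
        have "int (span w) dvd m - int q * int J"
          using span_dvd[OF ex J(1)] m(4) by (intro dvd_diff) auto
        also have "m - int q * int J = s"
          using ms by linarith
        finally show ?thesis
          using J0 by (simp add: R_def s_def)
      qed
      have "real q * real J \<le> B * real n"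
      proof -
        have "s \<ge> 0" using \<open>s \<in> R\<close> X(1) by (simp add: R_def)
        then have "int q * int J \<le> m" using ms by linarith
        then have "real_of_int (int q * int J) \<le> real_of_int m" by (simp only: of_int_le_iff)
        then show ?thesis using m(2) by simp
      qed
      then have "real q \<le> B / real J * real n"
        using J0 by (simp add: field_simps)
      moreover have "real L0 \<le> (1 - B / real J) * real n"
      proof -
        have "1 - B / real J > 0" using J J0 by (simp add: field_simps)
        moreover have "real L0 / (1 - B / real J) \<le> real n"
          using m(3) unfolding n0_def by linarith
        ultimately show ?thesis by (simp add: pos_divide_le_eq mult.commute)
      qed
      ultimately have "real (q + L0) \<le> real n" by (simp add: algebra_simps)
      then have qL: "q + L0 \<le> n" by linarith
      define r where "r = n - (q + L0)"
      have n: "n = L0 + (q + r)" using qL by (simp add: r_def)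
      have "n \<ge> 1" using m(3) by (simp add: n0_def)
      then have "(mu * c) ^ n \<le> mu * (c ^ q * c ^ r)"
      proof -
        have "mu ^ n \<le> mu ^ 1" using mu \<open>n \<ge> 1\<close> by (intro power_decreasing) auto
        moreover have "c ^ n \<le> c ^ (q + r)" using c n by (intro power_decreasing) auto
        ultimately show ?thesis
          using mu c by (simp add: power_mult_distrib power_add mult_mono)
      qed
      also have "\<dots> \<le> Z w s L0 * (w J ^ q * w 0 ^ r)"
        using c mu \<open>s \<in> R\<close> w by (intro mult_mono power_mono) (auto intro!: Z_nonneg)
      also have "\<dots> \<le> Z w s L0 * (Z w (int q * int J) q * Z w 0 r)"
        using w by (intro mult_mono ZJ Z0) (auto intro!: Z_nonneg mult_nonneg_nonneg)
      also have "\<dots> \<le> Z w s L0 * Z w (int q * int J) (q + r)"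
        using Z_mult_le[of w "int q * int J" q 0 r, OF w] by (intro mult_left_mono Z_nonneg w) auto
      also have "\<dots> \<le> Z w m n"
        using Z_mult_le[of w s L0 "int q * int J" "q + r", OF w] by (simp add: ms n)
      finally show "Z w m n \<ge> (mu * c) ^ n" .
    qed
  qed
qed

section \<open>Exponential lower bounds for finitely supported weights\<close>

text \<open>The linear bound \<open>y <= exp y\<close> yields an explicit radius outside which a
  single exponential term dominates a given constant.\<close>

lemma le_mult_exp:
  fixes A b c x :: real
  assumes "0 < b" "0 < c" "A / (c * b) \<le> x"
  shows "A \<le> c * exp (b * x)"
proof -
  have "A \<le> c * (b * x)"
    using assms by (simp add: pos_divide_le_eq mult_ac)
  also have "\<dots> \<le> c * exp (b * x)"
    using exp_ge_add_one_self[of "b * x"] assms by (intro mult_left_mono) linarith+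
  finally show ?thesis .
qed

text \<open>A counterpart of the Chernoff bound, by expanding the power. There is only an inequality
  because the right-hand side also counts allocations with entries above \<open>K\<close>.\<close>

lemma truncated_sum_power_le:
  assumes w: "\<And>i. w i \<ge> 0" and t: "t \<ge> 0"
  shows "(\<Sum>i\<le>K. w i * t ^ i) ^ N \<le> (\<Sum>m\<le>K * N. Z w (int m) N * t ^ m)"
proof (induction N)
  case 0
  then show ?case by (simp add: Z_0)
next
  case (Suc N)
  let ?g = "\<lambda>i l. w i * Z w (int l - int i) N * t ^ l"
  have g_nonneg: "?g i l \<ge> 0" for i l
    using w t Z_nonneg[of w] by simp
  have "(\<Sum>i\<le>K. w i * t ^ i) ^ Suc N
      \<le> (\<Sum>i\<le>K. w i * t ^ i) * (\<Sum>m\<le>K * N. Z w (int m) N * t ^ m)"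
    unfolding power_Suc using w t by (intro mult_left_mono Suc sum_nonneg) auto
  also have "\<dots> = (\<Sum>i\<le>K. \<Sum>m\<le>K * N. ?g i (m + i))"
    by (simp add: sum_product power_add mult_ac)
  also have "\<dots> \<le> (\<Sum>i\<le>K. \<Sum>l\<le>K * Suc N. ?g i l)"
  proof (rule sum_mono)
    fix i assume i: "i \<in> {..K}"
    have "(\<Sum>m\<le>K * N. ?g i (m + i)) = (\<Sum>l\<in>(\<lambda>m. m + i) ` {..K * N}. ?g i l)"
      by (subst sum.reindex) auto
    also have "\<dots> \<le> (\<Sum>l\<le>K * Suc N. ?g i l)"
      using i by (intro sum_mono2 g_nonneg) auto
    finally show "(\<Sum>m\<le>K * N. ?g i (m + i)) \<le> (\<Sum>l\<le>K * Suc N. ?g i l)" .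
  qed
  also have "\<dots> = (\<Sum>l\<le>K * Suc N. (\<Sum>i\<le>K. w i * Z w (int l - int i) N) * t ^ l)"
    by (subst sum.swap) (simp add: sum_distrib_right)
  also have "\<dots> \<le> (\<Sum>l\<le>K * Suc N. Z w (int l) (Suc N) * t ^ l)"
  proof (rule sum_mono, rule mult_right_mono)
    fix l
    have "(\<Sum>i\<le>K. w i * Z w (int l - int i) N) \<le> (\<Sum>i\<le>max K l. w i * Z w (int l - int i) N)"
      using w Z_nonneg[of w] by (intro sum_mono2) auto
    also have "\<dots> = Z w (int l) (Suc N)"
      by (rule Z_Suc[symmetric]) simp
    finally show "(\<Sum>i\<le>K. w i * Z w (int l - int i) N) \<le> Z w (int l) (Suc N)" .
  qed (use t in simp)
  finally show ?case .
qed

text \<open>The function is coercive: the term \<open>J\<close> blows up to the right because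
  \<open>lam < J\<close>, the term \<open>0\<close> to the left because \<open>lam > 0\<close>. So a
  minimum over a large compact interval is global.\<close>

lemma exp_minimizer:
  fixes v :: "nat \<Rightarrow> real"
  assumes v: "\<And>i. v i \<ge> 0" and v0: "v 0 > 0" and J: "J \<le> K" "v J > 0" and lam: "0 < lam" "lam < real J"
  obtains u where "\<And>s. (\<Sum>i\<le>K. v i * exp (s * real i)) * exp (- lam * s)
    \<ge> (\<Sum>i\<le>K. v i * exp (u * real i)) * exp (- lam * u)"
proof -
  define f where "f = (\<lambda>s. (\<Sum>i\<le>K. v i * exp (s * real i)) * exp (- lam * s))"
  have f_ge: "f s \<ge> v i * exp ((real i - lam) * s)" if "i \<le> K" for i s
  proof -
    have "v i * exp (s * real i) \<le> (\<Sum>i\<le>K. v i * exp (s * real i))"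
      using that v by (intro member_le_sum) auto
    then have "v i * exp (s * real i) * exp (- lam * s) \<le> f s"
      unfolding f_def by (intro mult_right_mono) auto
    then show ?thesis by (simp add: mult.assoc exp_add[symmetric] algebra_simps)
  qed
  have "f 0 > 0"
    using f_ge[of 0 0] v0 by simp
  define a where "a = f 0 / (v 0 * lam) + f 0 / (v J * (real J - lam))"
  have a: "f 0 / (v 0 * lam) \<le> a" "f 0 / (v J * (real J - lam)) \<le> a" "0 \<le> a"
    using \<open>f 0 > 0\<close> v0 J lam by (auto simp: a_def)
  have "continuous_on {-a..a} f"
    unfolding f_def by (intro continuous_intros)
  then obtain u where u: "u \<in> {-a..a}" "\<And>s. s \<in> {-a..a} \<Longrightarrow> f u \<le> f s"
    using continuous_attains_inf[of "{-a..a}" f] a by auto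
  have "f u \<le> f s" for s
  proof -
    consider "s \<in> {-a..a}" | "s > a" | "- s > a" by force
    then show ?thesis
    proof cases
      case 2
      have "f 0 \<le> v J * exp ((real J - lam) * s)"
        using a 2 lam J by (intro le_mult_exp) auto
      then show ?thesis using f_ge[of J s] J u(2)[of 0] a by auto
    next
      case 3
      have "f 0 \<le> v 0 * exp (lam * - s)"
        using a 3 lam v0 by (intro le_mult_exp) auto
      then show ?thesis using f_ge[of 0 s] u(2)[of 0] a by auto
    qed (use u in auto)
  qed
  then show ?thesis using that unfolding f_def by blast
qed

text \<open>The truncation level in \<open>ex\<close> depends on \<open>s\<close>. On a compact
  interval finitely many levels suffice by an open cover; outside it the terms \<open>0\<close> and
  \<open>J\<close> alone are large enough.\<close>

lemma uniform_truncation: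
  fixes w :: "nat \<Rightarrow> real"
  assumes w: "\<And>i. w i \<ge> 0" and w0: "w 0 > 0" and J: "w J > 0"
    and lam: "0 < lam" "lam < real J" and A: "A > 0"
    and ex: "\<And>s. \<exists>K. A * exp (lam * s) < (\<Sum>i\<le>K. w i * exp (s * real i))"
  obtains K where "J \<le> K" "\<forall>s. A * exp (lam * s) \<le> (\<Sum>i\<le>K. w i * exp (s * real i))"
proof -
  define P where "P = (\<lambda>K s. \<Sum>i\<le>K. w i * exp (s * real i))"
  have P_mono: "P K s \<le> P K' s" if "K \<le> K'" for K K' s
    unfolding P_def using that w by (intro sum_mono2) auto
  have P_ge: "w i * exp (s * real i) \<le> P K s" if "i \<le> K" for i K s
    unfolding P_def using that w by (intro member_le_sum) auto
  define a where "a = A / (w 0 * lam) + A / (w J * (real J - lam))"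
  have a: "A / (w 0 * lam) \<le> a" "A / (w J * (real J - lam)) \<le> a" "0 \<le> a"
    using A w0 J lam by (auto simp: a_def)
  have op: "open {s. A * exp (lam * s) < P K s}" for K
    unfolding P_def by (intro open_Collect_less continuous_intros)
  have "{-a..a} \<subseteq> (\<Union>K\<in>UNIV. {s. A * exp (lam * s) < P K s})"
    using ex by (auto simp: P_def)
  then obtain C where C: "finite C" "{-a..a} \<subseteq> (\<Union>K\<in>C. {s. A * exp (lam * s) < P K s})"
    by (rule compactE_image[OF compact_Icc op]) auto
  define K where "K = Max (insert J C)"
  have K: "J \<le> K" "\<And>k. k \<in> C \<Longrightarrow> k \<le> K"
    using C by (auto simp: K_def)
  have "A * exp (lam * s) \<le> P K s" for s
  proof -
    consider "s \<in> {-a..a}" | "s > a" | "- s > a" by force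
    then show ?thesis
    proof cases
      case 1
      then obtain k where "k \<in> C" "A * exp (lam * s) < P k s" using C by blast
      then show ?thesis using P_mono[OF K(2), of k s] by simp
    next
      case 2
      have "A \<le> w J * exp ((real J - lam) * s)"
        using a 2 lam J by (intro le_mult_exp) auto
      then have "A * exp (lam * s) \<le> w J * exp ((real J - lam) * s) * exp (lam * s)"
        by (intro mult_right_mono) auto
      also have "\<dots> = w J * exp (s * real J)"
        by (simp add: mult.assoc exp_add[symmetric] algebra_simps)
      finally show ?thesis using P_ge[OF K(1), of s] by simp
    next
      case 3
      have "A \<le> w 0 * exp (lam * - s)"
        using a 3 lam w0 by (intro le_mult_exp) auto
      then have "A * exp (lam * s) \<le> w 0 * exp (lam * - s) * exp (lam * s)"
        by (intro mult_right_mono) auto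
      also have "\<dots> = w 0"
        by (simp add: mult.assoc exp_add[symmetric])
      finally show ?thesis using P_ge[of 0 K s] by simp
    qed
  qed
  then show ?thesis using K(1) that[of K] unfolding P_def by blast
qed

text \<open>At the minimizer \<open>u\<close> of \<open>f\<close>, the terms of \<open>f u ^ N\<close> off the window \<open>\<bar>x - lam * N\<bar> \<le> eps * N\<close>
  are exponentially small compared to \<open>f u ^ N\<close>, because \<open>f' u = 0\<close>.\<close>

lemma large_coefficient_near_mean:
  fixes v :: "nat \<Rightarrow> real"
  assumes v: "\<And>i. v i \<ge> 0" and v0: "v 0 > 0" and J: "J \<le> K" "v J > 0" and lam: "0 < lam" "lam < real J"
    and vK: "\<And>i. i > K \<Longrightarrow> v i = 0"
    and A: "\<And>s. A * exp (lam * s) \<le> (\<Sum>i\<le>K. v i * exp (s * real i))"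
    and A': "0 < A'" "A' < A" and eps0: "eps > 0"
  obtains N x where "N \<ge> 1" "\<bar>real x - lam * real N\<bar> \<le> eps * real N" "A' ^ N \<le> Z v (int x) N"
proof (rule ccontr)
  assume "\<not> thesis"
  then have no: "Z v (int x) N < A' ^ N" if "N \<ge> 1" "\<bar>real x - lam * real N\<bar> \<le> eps * real N" for N x
    using that \<open>\<And>N x. \<lbrakk>N \<ge> 1; \<bar>real x - lam * real N\<bar> \<le> eps * real N; A' ^ N \<le> Z v (int x) N\<rbrakk> \<Longrightarrow> thesis\<close>
    by (meson not_le)
  define M where "M = (\<lambda>s. \<Sum>i\<le>K. v i * exp (s * real i))"
  define f where "f = (\<lambda>s. M s * exp (- lam * s))"
  obtain u where u: "\<And>s. f u \<le> f s"
    unfolding f_def M_def using exp_minimizer[OF v v0 J lam] by metis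
  have "A \<le> f u"
    using A[of u] by (simp add: f_def M_def exp_minus field_simps)
  then have fu: "f u > 0" using A' by linarith
  have M_pos: "M s \<ge> 0" for s unfolding M_def using v by (intro sum_nonneg) auto
  \<comment> \<open>The second bound gives \<open>A' * exp (\<bar>u\<bar> * e) < A\<close>, so
    tilting by \<open>u\<close> inside the narrower window does not use up the gap between
    \<open>A'\<close> and \<open>A\<close>. The summand \<open>1\<close> covers
    \<open>u = 0\<close>.\<close>
  define e where "e = min eps (ln (A / A') / (\<bar>u\<bar> + 1))"
  have e: "0 < e" "e \<le> eps" using eps0 A' by (auto simp: e_def)
  have "e * (\<bar>u\<bar> + 1) \<le> ln (A / A')"
    using pos_le_divide_eq[of "\<bar>u\<bar> + 1" e "ln (A / A')"] by (simp add: e_def)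
  then have "\<bar>u\<bar> * e < ln (A / A')" using e by (simp add: algebra_simps)
  then have "exp (\<bar>u\<bar> * e) < A / A'" using A' by (metis divide_pos_pos exp_less_cancel_iff exp_ln less_trans)
  then have mid: "A' * exp (\<bar>u\<bar> * e) < f u" using A' \<open>A \<le> f u\<close> by (simp add: field_simps)
  have "\<exists>D. (f has_real_derivative D) (at u)"
    unfolding f_def M_def by (rule exI) (auto intro!: derivative_eq_intros)
  then obtain D where D: "(f has_real_derivative D) (at u)" by blast
  \<comment> \<open>Since \<open>f\<close> is stationary at \<open>u\<close>, the factors
    \<open>exp (- e * (s - u))\<close> and \<open>exp (e * (s - u))\<close> force a strict decrease
    just to the right and just to the left of \<open>u\<close>. This supplies the parameters
    \<open>s1\<close> and \<open>s2\<close>.\<close>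
  have "D = 0"
    using DERIV_local_min[OF D, of 1] u by auto
  have "((\<lambda>s. f s * exp (- e * (s - u))) has_real_derivative - e * f u) (at u)"
    using D \<open>D = 0\<close> by (auto intro!: derivative_eq_intros)
  then obtain d1 where d1: "d1 > 0" "\<And>h. h > 0 \<Longrightarrow> h < d1 \<Longrightarrow> f (u + h) * exp (- e * (u + h - u)) < f u"
    using DERIV_neg_dec_right[of "\<lambda>s. f s * exp (- e * (s - u))" "- e * f u" u] e fu by auto
  define s1 where "s1 = u + d1 / 2"
  have s1: "s1 > u" "f s1 * exp (- e * (s1 - u)) < f u"
    using d1(1) d1(2)[of "d1 / 2"] by (auto simp: s1_def)
  have "((\<lambda>s. f s * exp (e * (s - u))) has_real_derivative e * f u) (at u)"
    using D \<open>D = 0\<close> by (auto intro!: derivative_eq_intros)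
  then obtain d2 where d2: "d2 > 0" "\<And>h. h > 0 \<Longrightarrow> h < d2 \<Longrightarrow> f (u - h) * exp (e * (u - h - u)) < f u"
    using DERIV_pos_inc_left[of "\<lambda>s. f s * exp (e * (s - u))" "e * f u" u] e fu by auto
  define s2 where "s2 = u - d2 / 2"
  have s2: "s2 < u" "f s2 * exp (e * (s2 - u)) < f u"
    using d2(1) d2(2)[of "d2 / 2"] by (auto simp: s2_def)
  define q where "q = max (A' * exp (\<bar>u\<bar> * e)) (max (f s1 * exp (- e * (s1 - u))) (f s2 * exp (e * (s2 - u))))"
  have q: "0 < q" "q < f u" "A' * exp (\<bar>u\<bar> * e) \<le> q" "f s1 * exp (- e * (s1 - u)) \<le> q" "f s2 * exp (e * (s2 - u)) \<le> q"
    using mid s1(2) s2(2) A' by (auto simp: q_def less_max_iff_disj)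
  have f_nonneg: "f s \<ge> 0" for s using M_pos by (simp add: f_def)
  have chern: "Z v (int x) N * exp (s * (real x - lam * real N)) \<le> f s ^ N" for x N s
  proof -
    have "Z v (int x) N * exp s powi int x \<le> M s ^ N"
    proof (rule Z_chernoff[OF v])
      fix K'
      have "(\<Sum>i\<le>K'. v i * exp s ^ i) \<le> (\<Sum>i\<le>max K K'. v i * exp s ^ i)"
        using v by (intro sum_mono2) auto
      also have "\<dots> = (\<Sum>i\<le>K. v i * exp s ^ i)"
        using vK by (intro sum.mono_neutral_right) auto
      finally show "(\<Sum>i\<le>K'. v i * exp s ^ i) \<le> M s"
        by (simp add: M_def exp_of_nat_mult[symmetric] mult.commute)
    qed simp
    then have "Z v (int x) N * exp s ^ x * exp (- lam * s) ^ N \<le> M s ^ N * exp (- lam * s) ^ N"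
      by (intro mult_right_mono) auto
    then show ?thesis
      by (simp add: f_def power_mult_distrib mult.assoc exp_of_nat_mult[symmetric] exp_add[symmetric] algebra_simps)
  qed
  \<comment> \<open>Inside the window the contradiction hypothesis bounds the coefficient; to its
    right and left the Chernoff bound is applied at \<open>s1\<close> and \<open>s2\<close> instead
    of \<open>u\<close>.\<close>
  have term_le: "Z v (int x) N * exp (u * (real x - lam * real N)) \<le> q ^ N" if N: "N \<ge> 1" for x N
  proof -
    define y where "y = real x - lam * real N"
    have Zn: "Z v (int x) N \<ge> 0" using Z_nonneg v by blast
    consider "\<bar>y\<bar> \<le> e * real N" | "y > e * real N" | "- y > e * real N" by linarith
    then show ?thesis
    proof cases
      case 1
      have "e * real N \<le> eps * real N" using e by (intro mult_right_mono) auto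
      then have "Z v (int x) N < A' ^ N"
        using 1 by (intro no N) (simp add: y_def)
      have "u * y \<le> \<bar>u\<bar> * (e * real N)"
        using 1 by (metis abs_ge_self abs_ge_zero abs_mult mult_left_mono order_trans)
      then have "Z v (int x) N * exp (u * y) \<le> A' ^ N * exp (\<bar>u\<bar> * (e * real N))"
        using \<open>Z v (int x) N < A' ^ N\<close> Zn A' by (intro mult_mono) auto
      also have "\<dots> = (A' * exp (\<bar>u\<bar> * e)) ^ N"
        by (simp add: power_mult_distrib exp_of_nat_mult[symmetric] mult_ac)
      also have "\<dots> \<le> q ^ N" using q A' by (intro power_mono) auto
      finally show ?thesis by (simp add: y_def)
    next
      case 2
      have "Z v (int x) N * exp (u * y) = Z v (int x) N * exp (s1 * y) * exp (- (s1 - u) * y)"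
        by (simp add: mult.assoc exp_add[symmetric] algebra_simps)
      also have "\<dots> \<le> f s1 ^ N * exp (- (s1 - u) * (e * real N))"
        using chern[of x N s1] 2 s1(1) f_nonneg by (intro mult_mono) (auto simp: y_def)
      also have "\<dots> = (f s1 * exp (- e * (s1 - u))) ^ N"
        by (simp add: power_mult_distrib exp_of_nat_mult[symmetric] algebra_simps)
      also have "\<dots> \<le> q ^ N" using q f_nonneg by (intro power_mono) auto
      finally show ?thesis by (simp add: y_def)
    next
      case 3
      have "(u - s2) * y \<le> (u - s2) * (- e * real N)"
        using 3 s2(1) by (intro mult_left_mono) auto
      then have *: "exp ((u - s2) * y) \<le> exp ((u - s2) * (- e * real N))"
        by simp
      have "Z v (int x) N * exp (u * y) = Z v (int x) N * exp (s2 * y) * exp ((u - s2) * y)"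
        by (simp add: mult.assoc exp_add[symmetric] algebra_simps)
      also have "\<dots> \<le> f s2 ^ N * exp ((u - s2) * (- e * real N))"
        using chern[of x N s2] f_nonneg by (intro mult_mono *) (auto simp: y_def)
      also have "\<dots> = (f s2 * exp (e * (s2 - u))) ^ N"
        by (simp add: power_mult_distrib exp_of_nat_mult[symmetric] algebra_simps)
      also have "\<dots> \<le> q ^ N" using q f_nonneg by (intro power_mono) auto
      finally show ?thesis by (simp add: y_def)
    qed
  qed
  \<comment> \<open>All \<open>K * N + 1\<close> terms in the expansion of \<open>f u ^ N\<close>
    are at most \<open>q ^ N\<close>, which is impossible for large \<open>N\<close> because
    \<open>q < f u\<close>.\<close>
  have bound: "f u ^ N \<le> real (K * N + 1) * q ^ N" if "N \<ge> 1" for N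
  proof -
    have "M u = (\<Sum>i\<le>K. v i * exp u ^ i)"
      by (simp add: M_def exp_of_nat_mult[symmetric] mult.commute)
    then have "M u ^ N \<le> (\<Sum>m\<le>K * N. Z v (int m) N * exp u ^ m)"
      using truncated_sum_power_le[of v "exp u" K N, OF v] by simp
    then have "M u ^ N * exp (- lam * u) ^ N \<le> (\<Sum>m\<le>K * N. Z v (int m) N * exp u ^ m) * exp (- lam * u) ^ N"
      by (intro mult_right_mono) auto
    also have "M u ^ N * exp (- lam * u) ^ N = f u ^ N"
      by (simp add: f_def power_mult_distrib)
    also have "(\<Sum>m\<le>K * N. Z v (int m) N * exp u ^ m) * exp (- lam * u) ^ N
        = (\<Sum>m\<le>K * N. Z v (int m) N * exp (u * (real m - lam * real N)))"
      unfolding sum_distrib_right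
      by (intro sum.cong) (simp_all add: mult.assoc exp_of_nat_mult[symmetric] exp_add[symmetric] algebra_simps)
    also have "\<dots> \<le> (\<Sum>m\<le>K * N. q ^ N)"
      using that by (intro sum_mono term_le)
    finally show ?thesis by (simp add: algebra_simps)
  qed
  have "(\<lambda>N. real K * (real N * (q / f u) ^ N) + (q / f u) ^ N) \<longlonglongrightarrow> real K * 0 + 0"
    using q fu by (intro tendsto_intros powser_times_n_limit_0 LIMSEQ_realpow_zero) auto
  then have "eventually (\<lambda>N. real K * (real N * (q / f u) ^ N) + (q / f u) ^ N < 1) sequentially"
    by (rule order_tendstoD(2)) simp
  then have "eventually (\<lambda>N. real K * (real N * (q / f u) ^ N) + (q / f u) ^ N < 1 \<and> N \<ge> 1) sequentially"
    using eventually_ge_at_top by (rule eventually_conj)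
  then obtain N where N: "real K * (real N * (q / f u) ^ N) + (q / f u) ^ N < 1" "N \<ge> 1"
    using eventually_happens' sequentially_bot by blast
  then have "real (K * N + 1) * q ^ N < f u ^ N"
    using fu by (simp add: power_divide field_simps)
  with bound[OF N(2)] show False by simp
qed

text \<open>A proportion \<open>1 - delta\<close> of the boxes is filled by copies of one good block of \<open>N\<close> boxes with
  \<open>x\<close> balls, and the remaining boxes by the crude lower bound, which costs little for small \<open>delta\<close>.\<close>

lemma Z_exponential_lower_bound:
  fixes w :: "nat \<Rightarrow> real" and m :: "'a \<Rightarrow> int" and n :: "'a \<Rightarrow> nat"
  assumes w: "\<And>i. w i \<ge> 0" and w0: "w 0 > 0" and ex: "\<exists>j\<ge>1. w j > 0"
    and lam: "0 < lam" "ereal lam < omega w"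
    and ge: "\<And>s. \<exists>K. A * exp (lam * s) < (\<Sum>i\<le>K. w i * exp (s * real i))"
    and A': "0 < A'" "A' < A"
    and n: "filterlim n at_top F" and mn: "((\<lambda>i. real_of_int (m i) / real (n i)) \<longlongrightarrow> lam) F"
    and dvd: "eventually (\<lambda>i. int (span w) dvd m i) F"
  shows "eventually (\<lambda>i. A' ^ n i \<le> Z w (m i) (n i)) F"
proof -
  obtain B where B: "lam < B" "ereal B < omega w"
    using ereal_dense2[OF lam(2)] by auto
  obtain J where J: "w J > 0" "lam < real J"
    using lam(2) by (auto simp: omega_def less_Sup_iff)
  have "A > 0" using A' by simp
  obtain K where K: "J \<le> K" "\<forall>s. A * exp (lam * s) \<le> (\<Sum>i\<le>K. w i * exp (s * real i))"
    by (rule uniform_truncation[of w J lam A, OF w w0 J(1) lam(1) J(2) \<open>A > 0\<close> ge])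
  obtain c X n0 where c: "c > 0" "X \<ge> 0"
    "\<forall>m n. X \<le> m \<longrightarrow> real_of_int m \<le> B * real n \<longrightarrow> n \<ge> n0 \<longrightarrow> int (span w) dvd m \<longrightarrow> Z w m n \<ge> c ^ n"
    by (rule Z_ge_power[of w B, OF w w0 ex less_trans[OF lam(1) B(1)] B(2)])
  define A1 where "A1 = (A' + A) / 2"
  have A1: "A' < A1" "A1 < A" "0 < A1" using A' by (auto simp: A1_def)
  define l where "l = ln A1 - ln A'"
  have "l > 0" using A' A1 by (simp add: l_def)
  \<comment> \<open>With \<open>delta <= l / a\<close>, giving the proportion \<open>delta\<close>
    of the boxes the rate \<open>ln c\<close> costs less than the gap \<open>l\<close>. The summand
    \<open>1\<close> makes this strict and keeps \<open>a\<close> positive.\<close>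
  define a where "a = \<bar>ln A1 - ln c\<bar> + 1"
  have "a > 0" by (simp add: a_def add_nonneg_pos)
  define delta where "delta = min (1 / 2) (l / a)"
  have delta: "0 < delta" "delta < 1" "delta \<le> l / a"
    using \<open>l > 0\<close> \<open>a > 0\<close> by (auto simp: delta_def)
  have rate: "(1 - delta) * ln A1 + delta * ln c > ln A'"
  proof -
    have "delta * (ln A1 - ln c) \<le> delta * \<bar>ln A1 - ln c\<bar>"
      using delta by (intro mult_left_mono) auto
    also have "\<dots> < delta * a"
      using delta by (intro mult_strict_left_mono) (auto simp: a_def)
    also have "\<dots> \<le> l"
      using delta \<open>a > 0\<close> by (simp add: pos_le_divide_eq)
    finally show ?thesis by (simp add: l_def algebra_simps)
  qed
  \<comment> \<open>Small enough that the leftover ball density \<open>g\<close> below lies strictly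
    between \<open>0\<close> and \<open>B * delta\<close>, the range of the crude bound.\<close>
  define eps where "eps = delta * min lam (B - lam) / 2"
  have eps: "eps > 0" "eps \<le> delta * lam / 2" "eps \<le> delta * (B - lam) / 2"
    using delta lam B by (auto simp: eps_def)
  define v where "v = (\<lambda>i. if i \<le> K then w i else 0)"
  have "\<exists>N x. N \<ge> 1 \<and> \<bar>real x - lam * real N\<bar> \<le> eps * real N \<and> A1 ^ N \<le> Z v (int x) N"
  proof (rule large_coefficient_near_mean[of v J K lam A A1 eps])
    show "A * exp (lam * s) \<le> (\<Sum>i\<le>K. v i * exp (s * real i))" for s
      using K(2) by (simp add: v_def)
  qed (use w w0 J K lam A1 eps in \<open>auto simp: v_def\<close>)
  then obtain N x where N: "N \<ge> 1" and x: "\<bar>real x - lam * real N\<bar> \<le> eps * real N" and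
    "A1 ^ N \<le> Z v (int x) N" by blast
  moreover have "Z v (int x) N \<le> Z w (int x) N"
    using w by (intro Z_mono) (auto simp: v_def)
  ultimately have A1N: "A1 ^ N \<le> Z w (int x) N" by simp
  define \<xi> where "\<xi> = real x / real N"
  have xi: "\<bar>\<xi> - lam\<bar> \<le> eps"
  proof -
    have "\<bar>\<xi> - lam\<bar> = \<bar>real x - lam * real N\<bar> / real N"
      using N by (simp add: \<xi>_def abs_divide field_simps)
    then show ?thesis using x N by (simp add: pos_divide_le_eq)
  qed
  define g where "g = lam - (1 - delta) * \<xi>"
  have g: "0 < g" "g < B * delta"
  proof -
    have "\<bar>(1 - delta) * (lam - \<xi>)\<bar> \<le> 1 * eps"
      unfolding abs_mult using xi delta by (intro mult_mono) auto
    moreover have "g = delta * lam + (1 - delta) * (lam - \<xi>)"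
      by (simp add: g_def algebra_simps)
    moreover have "delta * lam > 0" "delta * (B - lam) > 0" using delta lam B by auto
    ultimately show "0 < g" "g < B * delta"
      using eps by (auto simp: abs_le_iff right_diff_distrib mult.commute[of B])
  qed
  define q where "q = (\<lambda>i. nat \<lfloor>(1 - delta) * real (n i) / real N\<rfloor>)"
  have q: "(1 - delta) * real (n i) / real N - 1 \<le> real (q i)" "real (q i) \<le> (1 - delta) * real (n i) / real N" for i
  proof -
    have "(1 - delta) * real (n i) / real N \<ge> 0" using delta by simp
    then show "(1 - delta) * real (n i) / real N - 1 \<le> real (q i)" "real (q i) \<le> (1 - delta) * real (n i) / real N"
      unfolding q_def by linarith+
  qed
  have qN: "q i * N \<le> n i" for i
  proof -
    have "real (q i) * real N \<le> (1 - delta) * real (n i)"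
      using q(2)[of i] N by (simp add: pos_le_divide_eq)
    also have "\<dots> \<le> real (n i)" using delta by (simp add: algebra_simps)
    finally show ?thesis by (metis of_nat_le_iff of_nat_mult)
  qed
  have inv0: "((\<lambda>i. C / real (n i)) \<longlongrightarrow> 0) F" for C :: real
    using filterlim_compose[OF filterlim_real_sequentially n]
    by (intro real_tendsto_divide_at_top tendsto_const) auto
  have npos: "eventually (\<lambda>i. n i > 0) F"
    by (rule eventually_compose_filterlim[OF eventually_gt_at_top n])
  have q_lim: "((\<lambda>i. real (q i) / real (n i)) \<longlongrightarrow> (1 - delta) / real N) F"
  proof (rule tendsto_sandwich)
    have "((\<lambda>i. (1 - delta) / real N - 1 / real (n i)) \<longlongrightarrow> (1 - delta) / real N - 0) F"
      by (intro tendsto_intros inv0)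
    then show "((\<lambda>i. (1 - delta) / real N - 1 / real (n i)) \<longlongrightarrow> (1 - delta) / real N) F" by simp
    show "eventually (\<lambda>i. (1 - delta) / real N - 1 / real (n i) \<le> real (q i) / real (n i)) F"
      using npos
    proof eventually_elim
      case (elim i)
      have "((1 - delta) * real (n i) / real N - 1) / real (n i) \<le> real (q i) / real (n i)"
        using q(1)[of i] by (intro divide_right_mono) auto
      then show ?case using elim by (simp add: diff_divide_distrib)
    qed
    show "eventually (\<lambda>i. real (q i) / real (n i) \<le> (1 - delta) / real N) F"
      using npos
    proof eventually_elim
      case (elim i)
      have "real (q i) / real (n i) \<le> ((1 - delta) * real (n i) / real N) / real (n i)"
        using q(2)[of i] by (intro divide_right_mono) auto
      then show ?case using elim by simp
    qed
  qed auto
  define m' n' where "m' = (\<lambda>i. m i - int (q i) * int x)" and "n' = (\<lambda>i. n i - q i * N)"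
  have rn': "real (n' i) = real (n i) - real (q i) * real N" for i
    using qN[of i] by (simp add: n'_def of_nat_diff)
  have rm': "real_of_int (m' i) = real_of_int (m i) - real (q i) * real x" for i
    by (simp add: m'_def)
  have m_lim: "((\<lambda>i. real_of_int (m' i) / real (n i)) \<longlongrightarrow> g) F"
  proof -
    have "((\<lambda>i. real_of_int (m i) / real (n i) - real (q i) / real (n i) * real x) \<longlongrightarrow> lam - (1 - delta) / real N * real x) F"
      by (intro tendsto_intros mn q_lim)
    moreover have "lam - (1 - delta) / real N * real x = g"
      by (simp add: g_def \<xi>_def)
    ultimately show ?thesis by (simp add: rm' diff_divide_distrib)
  qed
  have n_lim: "((\<lambda>i. real (n' i) / real (n i)) \<longlongrightarrow> delta) F"
  proof -
    have "((\<lambda>i. 1 - real (q i) / real (n i) * real N) \<longlongrightarrow> 1 - (1 - delta) / real N * real N) F"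
      by (intro tendsto_intros q_lim)
    moreover have "eventually (\<lambda>i. 1 - real (q i) / real (n i) * real N = real (n' i) / real (n i)) F"
      using npos by eventually_elim (simp add: rn' field_simps)
    ultimately show ?thesis using N by (simp add: tendsto_cong)
  qed
  \<comment> \<open>Multiplied by \<open>n i\<close>, the next three limits give the size hypotheses
    of the crude bound for \<open>m' i\<close> and \<open>n' i\<close>; the fourth compares
    exponential rates.\<close>
  have "((\<lambda>i. real_of_int (m' i) / real (n i) - real_of_int X / real (n i)) \<longlongrightarrow> g - 0) F"
    by (intro tendsto_intros m_lim inv0)
  then have ev1: "eventually (\<lambda>i. real_of_int (m' i) / real (n i) - real_of_int X / real (n i) > 0) F"
    by (rule order_tendstoD(1)) (use g in simp)
  have "((\<lambda>i. B * (real (n' i) / real (n i)) - real_of_int (m' i) / real (n i)) \<longlongrightarrow> B * delta - g) F"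
    by (intro tendsto_intros m_lim n_lim)
  then have ev2: "eventually (\<lambda>i. B * (real (n' i) / real (n i)) - real_of_int (m' i) / real (n i) > 0) F"
    by (rule order_tendstoD(1)) (use g in simp)
  have "((\<lambda>i. real (n' i) / real (n i) - real n0 / real (n i)) \<longlongrightarrow> delta - 0) F"
    by (intro tendsto_intros n_lim inv0)
  then have ev3: "eventually (\<lambda>i. real (n' i) / real (n i) - real n0 / real (n i) > 0) F"
    by (rule order_tendstoD(1)) (use delta in simp)
  have "((\<lambda>i. real N * (real (q i) / real (n i)) * ln A1 + real (n' i) / real (n i) * ln c)
      \<longlongrightarrow> real N * ((1 - delta) / real N) * ln A1 + delta * ln c) F"
    by (intro tendsto_intros q_lim n_lim)
  then have ev4: "eventually (\<lambda>i. real N * (real (q i) / real (n i)) * ln A1 + real (n' i) / real (n i) * ln c > ln A') F"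
    by (rule order_tendstoD(1)) (use rate N in simp)
  from ev1 ev2 ev3 ev4 npos dvd show ?thesis
  proof eventually_elim
    case (elim i)
    have "X \<le> m' i" "real_of_int (m' i) \<le> B * real (n' i)" "n' i \<ge> n0"
      using elim(1-3,5) by (simp_all add: field_simps)
    moreover have "int (span w) dvd int x"
    proof (rule span_dvd_if_Z_nonzero[OF w ex])
      show "Z w (int x) N \<noteq> 0" using A1N A1 by (smt (verit) zero_less_power)
    qed
    then have "int (span w) dvd m' i"
      unfolding m'_def using elim(6) by (intro dvd_diff dvd_mult) auto
    ultimately have Zc: "Z w (m' i) (n' i) \<ge> c ^ n' i" using c(3) by blast
    have "real N * real (q i) * ln A1 + real (n' i) * ln c \<ge> real (n i) * ln A'"
      using elim(4,5) by (simp add: field_simps)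
    then have "exp (real (n i) * ln A') \<le> exp (real N * real (q i) * ln A1 + real (n' i) * ln c)"
      by simp
    also have "\<dots> = (A1 ^ N) ^ q i * c ^ n' i"
      using A1 c by (simp add: exp_add exp_of_nat_mult power_mult[symmetric] mult.assoc flip: of_nat_mult)
    finally have "A' ^ n i \<le> (A1 ^ N) ^ q i * c ^ n' i"
      using A' by (simp add: exp_of_nat_mult)
    also have "\<dots> \<le> Z w (int x) N ^ q i * Z w (m' i) (n' i)"
      using A1N A1(3) c(1) Zc Z_nonneg[of w, OF w] by (intro mult_mono power_mono) auto
    also have "\<dots> \<le> Z w (int (q i) * int x) (q i * N) * Z w (m' i) (n' i)"
      using w by (intro mult_right_mono Z_power_le Z_nonneg) auto
    also have "\<dots> \<le> Z w (int (q i) * int x + m' i) (q i * N + n' i)"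
      using w by (intro Z_mult_le)
    also have "\<dots> = Z w (m i) (n i)"
      using qN[of i] by (simp add: m'_def n'_def)
    finally show ?case .
  qed
qed

section \<open>The ratio limit from the variational characterization\<close>

text \<open>\<open>S\<close> is the value of the generating function at \<open>tau\<close>, and
  \<open>ge\<close> says that \<open>tau\<close> minimizes it after division by
  \<open>t powr lam\<close>. Partial sums express this also where the series diverges.\<close>

locale tilted_weights =
  fixes w :: "nat \<Rightarrow> real" and lam tau S :: real
  assumes w: "\<And>i. w i \<ge> 0" and w0: "w 0 > 0" and ex: "\<exists>j\<ge>1. w j > 0"
    and lam: "0 < lam" "ereal lam < omega w"
    and tau: "tau > 0" and S: "(\<lambda>i. w i * tau ^ i) sums S"
    and ge: "\<And>A s. A < S * tau powr (- lam) \<Longrightarrow> \<exists>K. A * exp (lam * s) < (\<Sum>i\<le>K. w i * exp (s * real i))"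
begin

lemma term_le_S: "w i * tau ^ i \<le> S"
  using S w tau sum_le_suminf[of "\<lambda>i. w i * tau ^ i" "{i}"] by (auto simp: sums_iff)

lemma S_pos: "S > 0"
  using term_le_S[of 0] w0 by simp

text \<open>A general filter accommodates the restriction to positive \<open>Z\<close> in the final
  limit. Divisibility by the span takes the place of positivity: unlike the latter, it is evidently
  stable under the shifts needed here, and it implies eventual positivity.\<close>

definition admissible :: "'a filter \<Rightarrow> ('a \<Rightarrow> int) \<Rightarrow> ('a \<Rightarrow> nat) \<Rightarrow> bool" where
  "admissible F m n \<longleftrightarrow> filterlim n at_top F \<and> ((\<lambda>i. real_of_int (m i) / real (n i)) \<longlongrightarrow> lam) F
    \<and> eventually (\<lambda>i. int (span w) dvd m i) F"

lemma admissible_eventually_pos: "admissible F m n \<Longrightarrow> eventually (\<lambda>i. n i > 0) F"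
  unfolding admissible_def using eventually_compose_filterlim[OF eventually_gt_at_top] by blast

lemma admissible_tendsto_0:
  assumes "admissible F m n"
  shows "((\<lambda>i. C / real (n i)) \<longlongrightarrow> 0) F"
proof -
  have "filterlim (\<lambda>i. real (n i)) at_top F"
    using assms filterlim_compose[OF filterlim_real_sequentially] unfolding admissible_def by blast
  then show ?thesis
    by (rule real_tendsto_divide_at_top[OF tendsto_const])
qed

lemma admissible_shift:
  assumes ad: "admissible F m n" and k: "int (span w) dvd k"
  shows "admissible F (\<lambda>i. m i + k) n"
  unfolding admissible_def
proof (intro conjI)
  have "((\<lambda>i. real_of_int (m i) / real (n i) + real_of_int k / real (n i)) \<longlongrightarrow> lam + 0) F"
    using ad admissible_tendsto_0[OF ad] by (intro tendsto_add) (auto simp: admissible_def)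
  then show "((\<lambda>i. real_of_int (m i + k) / real (n i)) \<longlongrightarrow> lam) F"
    by (simp add: add_divide_distrib)
  show "eventually (\<lambda>i. int (span w) dvd m i + k) F"
    using ad k unfolding admissible_def by (auto elim!: eventually_mono)
qed (use ad in \<open>simp add: admissible_def\<close>)

lemma admissible_Suc:
  assumes ad: "admissible F m n"
  shows "admissible F m (\<lambda>i. Suc (n i))"
  unfolding admissible_def
proof (intro conjI)
  show "filterlim (\<lambda>i. Suc (n i)) at_top F"
    using ad filterlim_compose[OF filterlim_Suc] unfolding admissible_def by blast
  have lim: "((\<lambda>i. real_of_int (m i) / real (n i) / (1 + 1 / real (n i))) \<longlongrightarrow> lam / (1 + 0)) F"
    using ad admissible_tendsto_0[OF ad] by (intro tendsto_intros) (auto simp: admissible_def)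
  have eq: "eventually (\<lambda>i. real_of_int (m i) / real (n i) / (1 + 1 / real (n i))
      = real_of_int (m i) / real (Suc (n i))) F"
    using admissible_eventually_pos[OF ad] by eventually_elim (simp add: field_simps)
  show "((\<lambda>i. real_of_int (m i) / real (Suc (n i))) \<longlongrightarrow> lam) F"
    using Lim_transform_eventually[OF lim eq] by simp
qed (use ad in \<open>simp add: admissible_def\<close>)

section \<open>Asymptotics of \<open>Z\<close> along admissible sequences\<close>

lemma Z_lower:
  assumes ad: "admissible F m n" and A: "0 < A" "A < S * tau powr (- lam)"
  shows "eventually (\<lambda>i. A ^ n i \<le> Z w (m i) (n i)) F"
proof -
  obtain A1 where A1: "A < A1" "A1 < S * tau powr (- lam)"
    using A(2) dense by blast
  show ?thesis
    using ad unfolding admissible_def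
    by (intro Z_exponential_lower_bound[OF w w0 ex lam ge[OF A1(2)] A(1) A1(1)]) auto
qed

lemma Z_eventually_pos:
  assumes ad: "admissible F m n"
  shows "eventually (\<lambda>i. Z w (m i) (n i) > 0) F"
proof -
  have "0 < S * tau powr (- lam)" using S_pos tau by simp
  then obtain A where A: "0 < A" "A < S * tau powr (- lam)" using dense by blast
  from Z_lower[OF ad A] show ?thesis
    by eventually_elim (use A in \<open>meson less_le_trans zero_less_power\<close>)
qed

text \<open>With \<open>e\<close> the proportion in question and \<open>v\<close> the weights with
  \<open>w j\<close> multiplied by \<open>exp s\<close>, one has \<open>exp (s * n * e) * Z w m n <=
  Z v m n <= (S * c) ^ n / tau ^ m\<close>. Taking logarithms and dividing by \<open>n\<close>
  cancels the rate of \<open>Z w m n\<close> up to \<open>eta\<close>.\<close>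

lemma tilt_estimate:
  fixes j :: nat and s eta :: real
  assumes ad: "admissible F m n" and eta: "eta > 0"
  defines "p \<equiv> w j * tau ^ j / S"
  shows "eventually (\<lambda>i. s * (w j * Z w (m i - int j) (n i - 1) / Z w (m i) (n i))
    \<le> ln (1 + (exp s - 1) * p) + eta) F"
proof -
  \<comment> \<open>Half of \<open>eta\<close> pays for the gap between \<open>A\<close> and the
    optimal rate, the other half for the deviation of \<open>m i / n i\<close> from
    \<open>lam\<close>.\<close>
  define A where "A = S * tau powr (- lam) * exp (- (eta / 2))"
  have A: "0 < A" "A < S * tau powr (- lam)"
    using S_pos tau eta by (auto simp: A_def)
  have lnA: "ln A = ln S - lam * ln tau - eta / 2"
    using S_pos tau by (simp add: A_def ln_mult ln_powr)
  have p: "0 \<le> p" "p \<le> 1"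
    using term_le_S[of j] S_pos w[of j] tau by (auto simp: p_def)
  define c where "c = 1 + (exp s - 1) * p"
  have "c > 0"
  proof -
    have "c = (1 - p) + exp s * p" by (simp add: c_def algebra_simps)
    then show ?thesis using p by (cases "p = 0") (auto intro: add_nonneg_pos)
  qed
  define v where "v = w(j := exp s * w j)"
  have v: "v i \<ge> 0" for i using w by (simp add: v_def)
  have "(\<lambda>i. w i * tau ^ i + (if i = j then (exp s - 1) * w i * tau ^ i else 0)) sums (S + (exp s - 1) * w j * tau ^ j)"
    by (intro sums_add S sums_single)
  moreover have "w i * tau ^ i + (if i = j then (exp s - 1) * w i * tau ^ i else 0) = v i * tau ^ i" for i
    by (simp add: v_def algebra_simps)
  moreover have "S + (exp s - 1) * w j * tau ^ j = S * c"
    using S_pos by (simp add: c_def p_def field_simps)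
  ultimately have v_sums: "(\<lambda>i. v i * tau ^ i) sums (S * c)" by simp
  have v_le: "(\<Sum>i\<le>K. v i * tau ^ i) \<le> S * c" for K
    using v_sums v tau sum_le_suminf[of "\<lambda>i. v i * tau ^ i" "{..K}"] by (auto simp: sums_iff)
  have "((\<lambda>i. (lam - real_of_int (m i) / real (n i)) * ln tau) \<longlongrightarrow> (lam - lam) * ln tau) F"
    using ad unfolding admissible_def by (intro tendsto_intros) auto
  then have "eventually (\<lambda>i. (lam - real_of_int (m i) / real (n i)) * ln tau < eta / 2) F"
    by (rule order_tendstoD(2)) (use eta in simp)
  then show ?thesis
    using Z_lower[OF ad A] Z_eventually_pos[OF ad] admissible_eventually_pos[OF ad]
  proof eventually_elim
    case (elim i)
    let ?Z = "Z w (m i) (n i)" and ?n = "real (n i)"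
    define e where "e = w j * Z w (m i - int j) (n i - 1) / ?Z"
    define a where "a = s * ?n * e"
    have "exp a * ((1 - a) * ?Z + s * ?n * w j * Z w (m i - int j) (n i - 1)) \<le> Z v (m i) (n i)"
      unfolding v_def by (rule Z_tilt_ge[OF w])
    also have "s * ?n * w j * Z w (m i - int j) (n i - 1) = a * ?Z"
      using elim(3) by (simp add: a_def e_def)
    finally have "exp a * ?Z \<le> Z v (m i) (n i)" by (simp add: algebra_simps)
    then have "exp a * ?Z * tau powi m i \<le> Z v (m i) (n i) * tau powi m i"
      using tau by (intro mult_right_mono) auto
    also have "\<dots> \<le> (S * c) ^ n i"
      by (rule Z_chernoff[OF v tau v_le])
    finally have "ln (exp a * ?Z * tau powi m i) \<le> ln ((S * c) ^ n i)"
      using elim(3) tau S_pos \<open>c > 0\<close> by (subst ln_le_cancel_iff) auto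
    then have 1: "a + ln ?Z + real_of_int (m i) * ln tau \<le> ?n * (ln S + ln c)"
      using elim(3) tau S_pos \<open>c > 0\<close> by (simp add: ln_mult ln_realpow ln_powr flip: powr_real_of_int')
    have "ln (A ^ n i) \<le> ln ?Z"
      using elim(2) A(1) elim(3) by (subst ln_le_cancel_iff) auto
    then have 2: "?n * (ln S - lam * ln tau - eta / 2) \<le> ln ?Z"
      using A(1) by (simp add: ln_realpow lnA)
    have "lam * ln tau * ?n - real_of_int (m i) * ln tau \<le> eta / 2 * ?n"
      using elim(1,4) by (simp add: field_simps)
    with 1 2 have "?n * (s * e) \<le> ?n * (ln c + eta)"
      by (simp add: a_def algebra_simps)
    then have "s * e \<le> ln c + eta" using elim(4) by simp
    then show ?case by (simp add: e_def c_def)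
  qed
qed

text \<open>The slope of \<open>s \<mapsto> ln (1 + (exp s - 1) * p)\<close> at \<open>0\<close> is \<open>p\<close>; small positive and
  negative \<open>s\<close> give the upper and lower bounds.\<close>

lemma box_probability_limit:
  assumes ad: "admissible F m n"
  shows "((\<lambda>i. w j * Z w (m i - int j) (n i - 1) / Z w (m i) (n i)) \<longlongrightarrow> w j * tau ^ j / S) F"
proof -
  define p where "p = w j * tau ^ j / S"
  define e where "e = (\<lambda>i. w j * Z w (m i - int j) (n i - 1) / Z w (m i) (n i))"
  define h where "h = (\<lambda>s. ln (1 + (exp s - 1) * p))"
  have est: "eventually (\<lambda>i. s * e i \<le> h s + eta) F" if "eta > 0" for s eta
    using tilt_estimate[OF ad that, where s = s and j = j] by (simp add: e_def h_def p_def)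
  have h: "((\<lambda>s. h s - s * b) has_real_derivative p - b) (at 0)" for b
    unfolding h_def by (auto intro!: derivative_eq_intros)
  have "h 0 = 0" by (simp add: h_def)
  have "(e \<longlongrightarrow> p) F"
  proof (rule order_tendstoI)
    fix b assume "p < b"
    then obtain d where d: "d > 0" "\<And>s. s > 0 \<Longrightarrow> s < d \<Longrightarrow> h s - s * b < 0"
      using DERIV_neg_dec_right[OF h[of b]] \<open>h 0 = 0\<close> by auto
    define s where "s = d / 2"
    have s: "s > 0" "h s < s * b" using d(1) d(2)[of s] by (auto simp: s_def)
    define eta where "eta = (s * b - h s) / 2"
    have eta: "eta > 0" "h s + 2 * eta = s * b" using s by (auto simp: eta_def field_simps)
    have "eventually (\<lambda>i. s * e i \<le> h s + eta) F"
      by (rule est) (rule eta)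
    then show "eventually (\<lambda>i. e i < b) F"
    proof eventually_elim
      case (elim i)
      then have "s * e i < s * b" using eta by linarith
      then show ?case using s by simp
    qed
  next
    fix b assume "b < p"
    then obtain d where d: "d > 0" "\<And>s. s > 0 \<Longrightarrow> s < d \<Longrightarrow> h (- s) + s * b < 0"
      using DERIV_pos_inc_left[OF h[of b]] \<open>h 0 = 0\<close> by auto
    define s where "s = d / 2"
    have s: "s > 0" "h (- s) < - s * b" using d(1) d(2)[of s] by (auto simp: s_def)
    define eta where "eta = (- s * b - h (- s)) / 2"
    have eta: "eta > 0" "h (- s) + 2 * eta = - (s * b)" using s by (auto simp: eta_def field_simps)
    have "eventually (\<lambda>i. - s * e i \<le> h (- s) + eta) F"
      by (rule est) (rule eta)
    then show "eventually (\<lambda>i. b < e i) F"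
    proof eventually_elim
      case (elim i)
      then have "s * b < s * e i" using eta by simp
      then show ?case using s by simp
    qed
  qed
  then show ?thesis by (simp add: e_def p_def)
qed

text \<open>The box proportions for \<open>j\<close> and for \<open>0\<close> are taken with
  \<open>Suc (n i)\<close> boxes, so that deleting one box leaves \<open>n i\<close>; their quotient
  cancels the common denominator.\<close>

lemma Z_ratio_support:
  assumes ad: "admissible F m n" and j: "w j > 0"
  shows "((\<lambda>i. Z w (m i - int j) (n i) / Z w (m i) (n i)) \<longlongrightarrow> tau ^ j) F"
proof -
  note ad' = admissible_Suc[OF ad]
  have lim: "((\<lambda>i. (w j * Z w (m i - int j) (n i) / Z w (m i) (Suc (n i)))
      / (w 0 * Z w (m i) (n i) / Z w (m i) (Suc (n i))) * (w 0 / w j))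
     \<longlongrightarrow> (w j * tau ^ j / S) / (w 0 / S) * (w 0 / w j)) F"
  proof (rule tendsto_mult[OF tendsto_divide tendsto_const])
    show "((\<lambda>i. w j * Z w (m i - int j) (n i) / Z w (m i) (Suc (n i))) \<longlongrightarrow> w j * tau ^ j / S) F"
      using box_probability_limit[OF ad', of j] by simp
    show "((\<lambda>i. w 0 * Z w (m i) (n i) / Z w (m i) (Suc (n i))) \<longlongrightarrow> w 0 / S) F"
      using box_probability_limit[OF ad', of 0] by simp
  qed (use w0 S_pos in simp)
  have eq: "eventually (\<lambda>i. (w j * Z w (m i - int j) (n i) / Z w (m i) (Suc (n i)))
      / (w 0 * Z w (m i) (n i) / Z w (m i) (Suc (n i))) * (w 0 / w j) = Z w (m i - int j) (n i) / Z w (m i) (n i)) F"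
    using Z_eventually_pos[OF ad] Z_eventually_pos[OF ad']
    by eventually_elim (use w0 j in \<open>simp add: field_simps\<close>)
  have "(w j * tau ^ j / S) / (w 0 / S) * (w 0 / w j) = tau ^ j"
    using w0 S_pos j by (simp add: field_simps)
  with Lim_transform_eventually[OF lim eq] show ?thesis
    by simp
qed

lemma Z_ratio:
  fixes F :: "'a filter"
  assumes ad: "admissible F m n" and k: "int (span w) dvd k"
  shows "((\<lambda>i. Z w (m i + k) (n i) / Z w (m i) (n i)) \<longlongrightarrow> tau powi (- k)) F"
proof -
  \<comment> \<open>The quantification over all \<open>m\<close> matters: for \<open>a - b\<close>
    both limits are used at the base point \<open>m - b\<close>.\<close>
  define H where "H = {k. int (span w) dvd k \<and> (\<forall>m. admissible F m n \<longrightarrow>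
    ((\<lambda>i. Z w (m i + k) (n i) / Z w (m i) (n i)) \<longlongrightarrow> tau powi (- k)) F)}"
  have H0: "0 \<in> H"
  proof -
    have "((\<lambda>i. Z w (m i) (n i) / Z w (m i) (n i)) \<longlongrightarrow> 1) F" if "admissible F m n" for m
    proof -
      have "eventually (\<lambda>i. Z w (m i) (n i) / Z w (m i) (n i) = 1) F"
        using Z_eventually_pos[OF that] by eventually_elim simp
      then show ?thesis by (simp add: tendsto_cong)
    qed
    then show ?thesis by (simp add: H_def)
  qed
  have H_diff: "a - b \<in> H" if a: "a \<in> H" and b: "b \<in> H" for a b
  proof -
    have dvd: "int (span w) dvd a" "int (span w) dvd b"
      using a b by (auto simp: H_def)
    have "((\<lambda>i. Z w (m i + (a - b)) (n i) / Z w (m i) (n i)) \<longlongrightarrow> tau powi (- (a - b))) F"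
      if ad: "admissible F m n" for m
    proof -
      have ad': "admissible F (\<lambda>i. m i - b) n"
        using admissible_shift[OF ad, of "- b"] dvd by simp
      have lim: "((\<lambda>i. (Z w ((m i - b) + a) (n i) / Z w (m i - b) (n i)) / (Z w ((m i - b) + b) (n i) / Z w (m i - b) (n i)))
        \<longlongrightarrow> tau powi (- a) / tau powi (- b)) F"
        using a b ad' tau by (intro tendsto_divide) (auto simp: H_def)
      have eq: "eventually (\<lambda>i. (Z w ((m i - b) + a) (n i) / Z w (m i - b) (n i)) / (Z w ((m i - b) + b) (n i) / Z w (m i - b) (n i))
          = Z w (m i + (a - b)) (n i) / Z w (m i) (n i)) F"
        using Z_eventually_pos[OF ad'] by eventually_elim (simp add: algebra_simps)
      have "tau powi (- a) / tau powi (- b) = tau powi (- (a - b))"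
        using tau power_int_diff[of tau "- a" "- b"] by simp
      with Lim_transform_eventually[OF lim eq] show ?thesis by simp
    qed
    then show ?thesis using dvd by (auto simp: H_def)
  qed
  have "k \<in> H"
  proof (rule multiple_of_span_in_subgroup[OF ex _ H0 H_diff k])
    fix j assume j: "w j > 0"
    \<comment> \<open>Removing \<open>j\<close> balls gives the negative shift first; closure under
      differences with \<open>0\<close> reverses the sign.\<close>
    have "- int j \<in> H"
      using span_dvd[OF ex j] Z_ratio_support[OF _ j] by (auto simp: H_def)
    then show "int j \<in> H" using H_diff[OF H0] by fastforce
  qed
  then show ?thesis using ad by (simp add: H_def)
qed

end

section \<open>The tilting parameter\<close>

text \<open>Jensen's inequality for the tilted distribution shows that \<open>tau\<close> minimizes
  \<open>t \<mapsto> Phi w t * t powr (- lam)\<close>; when its mean \<open>D / S\<close> is less than \<open>lam\<close>, this uses that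
  \<open>Phi\<close> is infinite to the right of \<open>tau\<close>.\<close>

lemma tilting_parameter_minimizes:
  fixes w :: "nat \<Rightarrow> real"
  assumes w: "\<And>i. w i \<ge> 0" and tau: "tau > 0"
    and S: "(\<lambda>i. w i * tau ^ i) sums S" and D: "(\<lambda>i. real i * (w i * tau ^ i)) sums D"
    and mean: "D = lam * S \<or> D \<le> lam * S \<and> (\<forall>t>tau. \<not> summable (\<lambda>i. w i * t ^ i))"
    and A: "A < S * tau powr (- lam)"
  shows "\<exists>K. A * exp (lam * s) < (\<Sum>i\<le>K. w i * exp (s * real i))"
proof (cases "summable (\<lambda>i. w i * exp (s * real i))")
  case False
  show ?thesis
  proof (rule ccontr)
    assume "\<not> ?thesis"
    then have le: "(\<Sum>i\<le>K. w i * exp (s * real i)) \<le> A * exp (lam * s)" for K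
      by (meson not_le)
    have "(\<Sum>i<K. w i * exp (s * real i)) \<le> A * exp (lam * s)" for K
    proof -
      have "(\<Sum>i<K. w i * exp (s * real i)) \<le> (\<Sum>i\<le>K. w i * exp (s * real i))"
        using w by (intro sum_mono2) auto
      then show ?thesis using le[of K] by simp
    qed
    then have "summable (\<lambda>i. w i * exp (s * real i))"
      using w by (intro summableI_nonneg_bounded) auto
    with False show False ..
  qed
next
  case True
  define u where "u = s - ln tau"
  have exp_s: "w i * exp (s * real i) = w i * exp s ^ i" for i
    by (simp add: exp_of_nat_mult[symmetric] mult.commute)
  \<comment> \<open>If the mean differs from \<open>lam\<close>, divergence beyond
    \<open>tau\<close> forces \<open>u <= 0\<close>, and both factors are nonpositive.\<close>
  have u: "0 \<le> u * (D - lam * S)"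
  proof (cases "D = lam * S")
    case False
    with mean have "D \<le> lam * S" "\<not> summable (\<lambda>i. w i * t ^ i)" if "t > tau" for t
      using that by auto
    then have "\<not> exp s > tau" using True unfolding exp_s by blast
    then have "s \<le> ln tau" using ln_ge_iff[OF tau, of s] by simp
    then have "u \<le> 0" by (simp add: u_def)
    moreover have "D \<le> lam * S" using mean by auto
    ultimately show ?thesis by (simp add: mult_nonpos_nonpos)
  qed simp
  define T where "T = (\<Sum>i. w i * exp (s * real i))"
  have T: "(\<lambda>i. w i * exp (s * real i)) sums T"
    unfolding T_def using True by (rule summable_sums)
  \<comment> \<open>The tangent bound \<open>1 + y <= exp y\<close> at
    \<open>y = u * i - lam * u\<close> is summed against \<open>w i * tau ^ i\<close>.\<close>
  have "(\<lambda>i. exp (lam * u) * ((1 - lam * u) * (w i * tau ^ i) + u * (real i * (w i * tau ^ i))))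
      sums (exp (lam * u) * ((1 - lam * u) * S + u * D))"
    by (intro sums_mult sums_add S D)
  moreover have "exp (lam * u) * ((1 - lam * u) * (w i * tau ^ i) + u * (real i * (w i * tau ^ i)))
      \<le> w i * exp (s * real i)" for i
  proof -
    have "exp (lam * u) * ((1 - lam * u) * (w i * tau ^ i) + u * (real i * (w i * tau ^ i)))
        = w i * tau ^ i * (exp (lam * u) * (1 + (u * real i - lam * u)))"
      by (simp add: algebra_simps)
    also have "\<dots> \<le> w i * tau ^ i * (exp (lam * u) * exp (u * real i - lam * u))"
      using w tau by (intro mult_left_mono exp_ge_add_one_self) auto
    also have "\<dots> = w i * (tau ^ i * exp (u * real i))"
      by (simp add: exp_add[symmetric])
    also have "tau ^ i * exp (u * real i) = exp (s * real i)"
    proof -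
      have "tau ^ i = exp (ln tau * real i)"
        using tau by (simp add: exp_of_nat2_mult)
      then show ?thesis by (simp add: u_def exp_add[symmetric] algebra_simps)
    qed
    finally show ?thesis .
  qed
  ultimately have "exp (lam * u) * ((1 - lam * u) * S + u * D) \<le> T"
    by (rule sums_le[rotated 1, OF _ T])
  moreover have "(1 - lam * u) * S + u * D \<ge> S"
    using u by (simp add: algebra_simps)
  then have "exp (lam * u) * S \<le> exp (lam * u) * ((1 - lam * u) * S + u * D)"
    by (intro mult_left_mono) auto
  moreover have "exp (lam * u) * S = S * tau powr (- lam) * exp (lam * s)"
    using tau by (simp add: u_def powr_def exp_add[symmetric] algebra_simps)
  moreover have "A * exp (lam * s) < S * tau powr (- lam) * exp (lam * s)"
    using A by simp
  ultimately have "A * exp (lam * s) < T" by linarith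
  moreover have "(\<lambda>K. \<Sum>i\<le>K. w i * exp (s * real i)) \<longlonglongrightarrow> T"
    using T by (simp add: sums_def_le)
  ultimately have "eventually (\<lambda>K. A * exp (lam * s) < (\<Sum>i\<le>K. w i * exp (s * real i))) sequentially"
    by (rule order_tendstoD(1)[rotated])
  then show ?thesis by (auto dest: eventually_happens)
qed

section \<open>The extended-real \<open>Phi\<close> and \<open>Psi0\<close> in terms of real
  series\<close>

lemma Phi_summable:
  assumes w: "\<And>i. w i \<ge> 0" and "t \<ge> 0" and "summable (\<lambda>i. w i * t ^ i)"
  shows "Phi w t = ennreal (\<Sum>i. w i * t ^ i)"
  unfolding Phi_def using assms by (intro suminf_ennreal2) auto

lemma Phi_finite:
  assumes w: "\<And>i. w i \<ge> 0" and "t \<ge> 0" and "Phi w t < \<infinity>"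
  shows "summable (\<lambda>i. w i * t ^ i)" "Phi w t = ennreal (\<Sum>i. w i * t ^ i)"
proof -
  show s: "summable (\<lambda>i. w i * t ^ i)"
    using assms by (intro summable_suminf_not_top) (auto simp: Phi_def)
  show "Phi w t = ennreal (\<Sum>i. w i * t ^ i)"
    using assms(1,2) s by (rule Phi_summable)
qed

lemma mult_PhiD:
  assumes w: "\<And>i. w i \<ge> 0" and t: "t \<ge> 0"
  shows "ennreal t * PhiD w t = (\<Sum>i. ennreal (real i * (w i * t ^ i)))"
proof -
  have "ennreal t * PhiD w t = (\<Sum>i. ennreal t * ennreal (real i * w i * t ^ (i - 1)))"
    unfolding PhiD_def by simp
  also have "\<dots> = (\<Sum>i. ennreal (real i * (w i * t ^ i)))"
  proof (rule suminf_cong)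
    fix i
    \<comment> \<open>At \<open>i = 0\<close> the truncated exponent \<open>i - 1\<close> is
      harmless because the factor \<open>real i\<close> vanishes.\<close>
    have "t * (real i * w i * t ^ (i - 1)) = real i * (w i * t ^ i)"
      by (cases i) auto
    then show "ennreal t * ennreal (real i * w i * t ^ (i - 1)) = ennreal (real i * (w i * t ^ i))"
      using t w by (simp add: ennreal_mult[symmetric])
  qed
  finally show ?thesis .
qed

text \<open>The product form avoids extended division: \<open>Phi w t\<close> is finite by
  assumption and nonzero because of \<open>w 0 > 0\<close>, so it cancels.\<close>

lemma Psi0_times_Phi:
  assumes w: "\<And>i. w i \<ge> 0" "w 0 > 0" and t: "t \<ge> 0" and "Phi w t < \<infinity>"
  shows "Psi0 w t * Phi w t = (\<Sum>i. ennreal (real i * (w i * t ^ i)))"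
proof -
  have "0 < w 0 * t ^ 0" using w by simp
  also have "\<dots> \<le> (\<Sum>i. w i * t ^ i)"
    using sum_le_suminf[OF Phi_finite(1)[OF w(1) t assms(4)], of "{0}"] w t by auto
  finally have "Phi w t \<noteq> 0"
    using Phi_finite(2)[of w t] assms by simp
  then have "Psi0 w t * Phi w t = ennreal t * PhiD w t"
    unfolding Psi0_def using assms(4) by (simp add: ennreal_divide_times)
  then show ?thesis by (simp add: mult_PhiD w t)
qed

text \<open>If \<open>Phi w tau\<close> is infinite, then a fixed number of initial terms is negligible as
  \<open>t\<close> approaches \<open>tau\<close>, so the mean of the tilted distribution exceeds every bound.\<close>

lemma Psi_eq_top:
  assumes w: "\<And>i. w i \<ge> 0" "w 0 > 0" and tau: "tau > 0" "ereal tau \<le> conv_radius w" and inf: "Phi w tau = \<infinity>"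
  shows "Psi w tau = \<infinity>"
proof -
  have "(Psi0 w \<longlongrightarrow> top) (at_left tau)"
    unfolding tendsto_top_iff_ennreal
  proof (intro allI impI)
    fix l :: real assume "l \<ge> 0"
    \<comment> \<open>The indices below \<open>B\<close> carry mass at most \<open>C\<close>. Once
      the total mass \<open>s\<close> exceeds \<open>2 * C\<close>, more than half of it sits at
      indices from \<open>B\<close> on, and the mean exceeds \<open>B / 2 > l\<close>.\<close>
    obtain B :: nat where B: "real B > 2 * l" using reals_Archimedean2 by blast
    define C where "C = (\<Sum>i<B. w i * tau ^ i)"
    have "\<exists>K. (\<Sum>i<K. w i * tau ^ i) > 2 * C"
    proof (rule ccontr)
      assume "\<not> ?thesis"
      then have "(\<Sum>i<K. w i * tau ^ i) \<le> 2 * C" for K by (meson not_le)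
      then have "summable (\<lambda>i. w i * tau ^ i)"
        using w tau by (intro summableI_nonneg_bounded) auto
      then show False using inf Phi_summable[of w tau, OF w(1)] tau by simp
    qed
    then obtain K where K: "(\<Sum>i<K. w i * tau ^ i) > 2 * C" by blast
    have "((\<lambda>t. \<Sum>i<K. w i * t ^ i) \<longlongrightarrow> (\<Sum>i<K. w i * tau ^ i)) (at_left tau)"
      by (intro tendsto_intros)
    then have "eventually (\<lambda>t. (\<Sum>i<K. w i * t ^ i) > 2 * C) (at_left tau)"
      using K by (rule order_tendstoD(1))
    moreover have "eventually (\<lambda>t. t \<in> {0<..<tau}) (at_left tau)"
      using tau by (intro eventually_at_left_real)
    ultimately show "eventually (\<lambda>t. ennreal l < Psi0 w t) (at_left tau)"
    proof eventually_elim
      case (elim t)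
      have "ereal (norm t) < conv_radius w"
        using elim(2) tau(2) by (simp add: order_less_le_trans[of _ "ereal tau"])
      then have summ: "summable (\<lambda>i. w i * t ^ i)" by (rule summable_in_conv_radius)
      define s where "s = (\<Sum>i. w i * t ^ i)"
      have Phi: "Phi w t = ennreal s"
        unfolding s_def using elim(2) summ w by (intro Phi_summable) auto
      have partial: "(\<Sum>i\<in>I. w i * t ^ i) \<le> s" if "finite I" for I
        unfolding s_def using summ that w elim(2) by (intro sum_le_suminf) auto
      have "s > 2 * C" using partial[of "{..<K}"] elim(1) by simp
      have "s > 0" using partial[of "{0}"] w by simp
      have "real B * s - real B * C > l * s"
      proof -
        have "real B * C \<le> real B * (s / 2)"
          using \<open>s > 2 * C\<close> by (intro mult_left_mono) auto
        moreover have "2 * l * s < real B * s"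
          using B \<open>s > 0\<close> by (intro mult_strict_right_mono)
        ultimately show ?thesis by simp
      qed
      moreover have "(\<lambda>M. real B * (\<Sum>i<M. w i * t ^ i) - real B * C) \<longlonglongrightarrow> real B * s - real B * C"
        using summable_LIMSEQ[OF summ] unfolding s_def by (intro tendsto_intros)
      ultimately have "eventually (\<lambda>M. l * s < real B * (\<Sum>i<M. w i * t ^ i) - real B * C) sequentially"
        by (intro order_tendstoD(1))
      then obtain M where M: "l * s < real B * (\<Sum>i<M. w i * t ^ i) - real B * C"
        by (auto dest: eventually_happens)
      have "real B * (\<Sum>i<M. w i * t ^ i) - real B * C \<le> (\<Sum>i<M. real i * (w i * t ^ i))"
      proof -
        have "real B * (\<Sum>i<M. w i * t ^ i) \<le> (\<Sum>i<M. real i * (w i * t ^ i) + (if i < B then real B * (w i * tau ^ i) else 0))"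
          unfolding sum_distrib_left
        proof (rule sum_mono)
          fix i
          have "w i * t ^ i \<le> w i * tau ^ i"
            using w elim(2) by (intro mult_left_mono power_mono) auto
          then have "real B * (w i * t ^ i) \<le> real B * (w i * tau ^ i)"
            by (rule mult_left_mono) simp
          moreover have "0 \<le> real i * (w i * t ^ i)" using w elim(2) by simp
          moreover have "real B * (w i * t ^ i) \<le> real i * (w i * t ^ i)" if "\<not> i < B"
            using that w elim(2) by (intro mult_right_mono) auto
          ultimately show "real B * (w i * t ^ i) \<le> real i * (w i * t ^ i) + (if i < B then real B * (w i * tau ^ i) else 0)"
            by auto
        qed
        also have "\<dots> = (\<Sum>i<M. real i * (w i * t ^ i)) + (\<Sum>i\<in>{..<M} \<inter> {..<B}. real B * (w i * tau ^ i))"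
          by (simp add: sum.distrib sum.inter_restrict)
        also have "(\<Sum>i\<in>{..<M} \<inter> {..<B}. real B * (w i * tau ^ i)) \<le> real B * C"
          unfolding C_def sum_distrib_left using w tau by (intro sum_mono2) auto
        finally show ?thesis by simp
      qed
      with M have "ennreal (l * s) < ennreal (\<Sum>i<M. real i * (w i * t ^ i))"
        using \<open>l \<ge> 0\<close> \<open>s > 0\<close> by (simp add: ennreal_less_iff)
      also have "\<dots> = (\<Sum>i<M. ennreal (real i * (w i * t ^ i)))"
        using w elim(2) by (intro sum_ennreal[symmetric]) auto
      also have "\<dots> \<le> (\<Sum>i. ennreal (real i * (w i * t ^ i)))"
        by (intro sum_le_suminf) auto
      also have "\<dots> = Psi0 w t * Phi w t"
        using elim(2) w Phi by (intro Psi0_times_Phi[symmetric]) auto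
      finally have less: "ennreal l * ennreal s < Psi0 w t * ennreal s"
        using \<open>l \<ge> 0\<close> \<open>s > 0\<close> Phi by (simp add: ennreal_mult)
      show "ennreal l < Psi0 w t"
      proof (rule ccontr)
        assume "\<not> ?thesis"
        then have "Psi0 w t * ennreal s \<le> ennreal l * ennreal s"
          by (intro mult_right_mono) auto
        with less show False by simp
      qed
    qed
  qed
  then have "Lim (at_left tau) (Psi0 w) = top"
    by (intro tendsto_Lim) (simp_all add: trivial_limit_at_left_real)
  then show ?thesis using inf by (simp add: Psi_def)
qed

section \<open>From the conditions on \<open>nu\<close> and \<open>Psi\<close> to the minimizing
  property\<close>

lemma tilting_parameter_pos:
  assumes w: "\<And>i. w i \<ge> 0" and "tau \<ge> 0" and "Psi w tau = ennreal lam" and "lam > 0"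
  shows "tau > 0"
proof (rule ccontr)
  assume "\<not> tau > 0"
  then have "tau = 0" using assms by simp
  have "Phi w 0 < \<infinity>"
    using Phi_summable[of w 0, OF w] by simp
  then have "Psi w tau = 0"
    by (simp add: \<open>tau = 0\<close> Psi_def Psi0_def)
  then show False using assms by simp
qed

lemma tilted_weightsI:
  assumes w: "\<And>i. w i \<ge> 0" "w 0 > 0" "\<exists>j\<ge>1. w j > 0"
    and lam: "0 < lam" "ereal lam < omega w"
    and tau: "0 \<le> tau" "ereal tau \<le> conv_radius w" "conv_radius w > 0"
    and le: "ennreal lam \<le> nu w \<Longrightarrow> Psi w tau = ennreal lam"
    and gt: "ennreal lam > nu w \<Longrightarrow> ereal tau = conv_radius w"
  shows "tilted_weights w lam tau (\<Sum>i. w i * tau ^ i)"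
proof -
  \<comment> \<open>For \<open>lam\<close> above \<open>nu w\<close> the radius of convergence
    equals the real number \<open>tau\<close>, so \<open>nu w\<close> is given by its finite-radius
    case, the value of \<open>Psi\<close> at \<open>tau\<close>.\<close>
  have Psi: "Psi w tau = ennreal lam \<or> Psi w tau < ennreal lam \<and> ereal tau = conv_radius w"
  proof (cases "ennreal lam \<le> nu w")
    case False
    then have rho: "ereal tau = conv_radius w" using gt by simp
    then have "nu w = Psi w tau" by (simp add: nu_def flip: rho)
    with False rho show ?thesis by auto
  qed (use le in simp)
  have tau_pos: "tau > 0"
    using Psi
  proof
    assume "Psi w tau = ennreal lam"
    then show ?thesis by (rule tilting_parameter_pos[OF w(1) tau(1) _ lam(1)])
  next
    assume "Psi w tau < ennreal lam \<and> ereal tau = conv_radius w"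
    then show ?thesis using tau by (metis ereal_less(2))
  qed
  \<comment> \<open>A finite \<open>Psi\<close> excludes an infinite \<open>Phi\<close>, so the
    limit clause in the definition of \<open>Psi\<close> does not apply at
    \<open>tau\<close>.\<close>
  have "Psi w tau < \<infinity>"
    using Psi by (auto intro: less_trans)
  then have fin: "Phi w tau < \<infinity>"
    using Psi_eq_top[OF w(1,2) tau_pos tau(2)] by (cases "Phi w tau = \<infinity>") (auto simp: less_top)
  define S where "S = (\<Sum>i. w i * tau ^ i)"
  have S: "(\<lambda>i. w i * tau ^ i) sums S"
    unfolding S_def using Phi_finite(1)[OF w(1) tau(1) fin] by (rule summable_sums)
  have S0: "S \<ge> 0" unfolding S_def using w tau by (intro suminf_nonneg Phi_finite(1)[OF _ _ fin]) auto
  have PhiS: "Phi w tau = ennreal S"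
    unfolding S_def using w tau fin by (intro Phi_finite(2)) auto
  have PsiS: "Psi w tau * ennreal S = (\<Sum>i. ennreal (real i * (w i * tau ^ i)))"
    using Psi0_times_Phi[OF w(1,2) tau(1) fin] fin by (simp add: Psi_def PhiS)
  have le_lam: "Psi w tau * ennreal S \<le> ennreal (lam * S)"
    using Psi lam S0 by (auto simp: ennreal_mult intro!: mult_right_mono)
  have summ: "summable (\<lambda>i. real i * (w i * tau ^ i))"
  proof (rule summable_suminf_not_top)
    show "(\<Sum>i. ennreal (real i * (w i * tau ^ i))) \<noteq> top"
      using le_lam by (auto simp: PsiS top_unique)
  qed (use w tau in auto)
  define D where "D = (\<Sum>i. real i * (w i * tau ^ i))"
  have D: "(\<lambda>i. real i * (w i * tau ^ i)) sums D"
    unfolding D_def using summ by (rule summable_sums)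
  have D0: "D \<ge> 0" unfolding D_def using w tau by (intro suminf_nonneg summ) auto
  have PsiD: "Psi w tau * ennreal S = ennreal D"
    unfolding PsiS D_def using w tau summ by (intro suminf_ennreal2) auto
  have mean: "D = lam * S \<or> D \<le> lam * S \<and> (\<forall>t>tau. \<not> summable (\<lambda>i. w i * t ^ i))"
    using Psi
  proof
    assume "Psi w tau = ennreal lam"
    then have "ennreal (lam * S) = ennreal D"
      using PsiD lam S0 by (simp add: ennreal_mult)
    then show ?thesis using D0 S0 lam by simp
  next
    assume *: "Psi w tau < ennreal lam \<and> ereal tau = conv_radius w"
    have "D \<le> lam * S"
      using le_lam lam S0 by (simp add: PsiD)
    moreover have "\<not> summable (\<lambda>i. w i * t ^ i)" if "t > tau" for t
      using conv_radius_geI[of w t] * that tau_pos by (metis abs_of_pos ereal_less_eq(3) less_trans not_le real_norm_def)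
    ultimately show ?thesis by blast
  qed
  have "tilted_weights w lam tau S"
    using tilting_parameter_minimizes[OF w(1) tau_pos S D mean]
    by unfold_locales (use w lam tau_pos S in auto)
  then show ?thesis by (simp add: S_def)
qed

theorem theorem17p8:
  fixes w :: "nat \<Rightarrow> real" and m :: "nat \<Rightarrow> nat"
    and lam :: real and tau :: real and k :: int
  assumes "weight_seq w"
    and "w 0 > 0"
    and "\<exists>j\<ge>1. w j > 0"
    and "(\<lambda>n. real (m n) / real n) \<longlonglongrightarrow> lam"
    and "0 < lam" and "ereal lam < omega w"
    and "0 \<le> tau" and "ereal tau \<le> conv_radius w"
    and "ennreal lam \<le> nu w \<Longrightarrow> Psi w tau = ennreal lam"
    and "ennreal lam > nu w \<Longrightarrow> ereal tau = conv_radius w"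
    and "conv_radius w > 0"
    and "int (span w) dvd k"
  shows "filterlim (\<lambda>n. Z w (int (m n) + k) n / Z w (int (m n)) n) (nhds (tau powi (- k)))
           (inf sequentially (principal {n. Z w (int (m n)) n > 0}))"
proof -
  have w: "w i \<ge> 0" for i
    using assms(1) by (simp add: weight_seq_def)
  interpret tilted_weights w lam tau "\<Sum>i. w i * tau ^ i"
    by (rule tilted_weightsI) (use w assms in auto)
  let ?F = "inf sequentially (principal {n. Z w (int (m n)) n > 0})"
  have F: "?F \<le> sequentially" by simp
  have "admissible ?F (\<lambda>n. int (m n)) (\<lambda>n. n)"
    unfolding admissible_def
  proof (intro conjI)
    show "filterlim (\<lambda>n. n) at_top ?F"
      using F by (simp add: filterlim_def)
    show "((\<lambda>n. real_of_int (int (m n)) / real n) \<longlongrightarrow> lam) ?F"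
      using tendsto_mono[OF F assms(4)] by simp
    \<comment> \<open>Restricting to \<open>n\<close> with positive \<open>Z\<close> supplies the
      divisibility required by \<open>admissible\<close>.\<close>
    have "int (span w) dvd int (m n)" if "Z w (int (m n)) n > 0" for n
      using span_dvd_if_Z_nonzero[of w "int (m n)" n, OF w assms(3)] that by simp
    then show "eventually (\<lambda>n. int (span w) dvd int (m n)) ?F"
      by (simp add: eventually_inf_principal)
  qed
  then show ?thesis
    using assms(12) by (rule Z_ratio)
qed

end
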